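(* Let $d\ge1$, let $C\subset\mathbb{R}^d$ be a closed convex cone, and let $\mathbf{g}\sim\mathcal{N}(0,I_d)$. Define $$v:=\|E[\Pi_C(\mathbf{g})]\|^2\quad\text{and}\quad b:=\sqrt{d\,\delta_C/2},$$ where $\delta_C$ is the statistical dimension of $C$. Then $$\frac{\min(v^2,4b^2)}{b}\le\mathrm{Var}(V_C)\le2v.$$
   Context: A set $C\subset\mathbb{R}^d$ is a convex cone if $a\mathbf{x}+b\mathbf{y}\in C$ whenever $\mathbf{x},\mathbf{y}\in C$ and $a,b$ are positive reals. For a closed convex cone $C\subset\mathbb{R}^d$, $\Pi_C(\mathbf{x})$ denotes the metric projection of $\mathbf{x}$ onto $C$ (the unique nearest point of $C$ in the Euclidean norm $\|\cdot\|$) and $C^0=\{\mathbf{y}\in\mathbb{R}^d:\langle\mathbf{y},\mathbf{x}\rangle\le0\ \forall\mathbf{x}\in C\}$ is the polar cone. The conic intrinsic volumes $v_0,\dots,v_d$ of $C$ are the uniquely determined nonnegative numbers summing to one such that, for $\mathbf{g}\sim\mathcal{N}(0,I_d)$ (the standard Gaussian law on $\mathbb{R}^d$) and every bounded measurable $f:\mathbb{R}_+^2\to\mathbb{R}$, $$E f(\|\Pi_C(\mathbf{g})\|^2,\|\Pi_{C^0}(\mathbf{g})\|^2)=\sum_{j=0}^d v_j\,E f(Y_j,Y'_{d-j}),$$ where the $Y_j,Y_j'$ are independent and $Y_j,Y_j'$ have the chi-squared distribution with $j$ degrees of freedom ($\chi^2_0$ is the point mass at $0$). $V_C$ denotes a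 random variable with $P(V_C=j)=v_j$, $j=0,\dots,d$, and $\delta_C=E[V_C]=E\|\Pi_C(\mathbf{g})\|^2$ is the statistical dimension of $C$. *)

theory Defs
  imports "HOL-Probability.Probability"
begin

text \<open>On closed sets, the library's \<^const>\<open>convex_cone\<close> (which includes nonemptiness and closure under
  multiplication by 0) is the notion of a nonempty set closed under positive combinations.\<close>

lemma closed_convex_cone_iff:
  fixes C :: "'a::real_normed_vector set"
  assumes "closed C"
  shows "convex_cone C \<longleftrightarrow>
    C \<noteq> {} \<and> (\<forall>x\<in>C. \<forall>y\<in>C. \<forall>a>0. \<forall>b>0. a *\<^sub>R x + b *\<^sub>R y \<in> C)"
proof
  assume "convex_cone C"
  then show "C \<noteq> {} \<and> (\<forall>x\<in>C. \<forall>y\<in>C. \<forall>a>0. \<forall>b>0. a *\<^sub>R x + b *\<^sub>R y \<in> C)"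
    by (auto simp: convex_cone_iff)
next
  assume *: "C \<noteq> {} \<and> (\<forall>x\<in>C. \<forall>y\<in>C. \<forall>a>0. \<forall>b>0. a *\<^sub>R x + b *\<^sub>R y \<in> C)"
  have scale: "c *\<^sub>R x \<in> C" if "x \<in> C" "c > 0" for c x
  proof -
    have "(c/2) *\<^sub>R x + (c/2) *\<^sub>R x \<in> C"
      using * that by auto
    then show ?thesis
      by (simp add: scaleR_add_left[symmetric])
  qed
  have add: "x + y \<in> C" if "x \<in> C" "y \<in> C" for x y
  proof -
    have "(1::real) *\<^sub>R x + (1::real) *\<^sub>R y \<in> C"
      using * that zero_less_one by blast
    then show ?thesis by simp
  qed
  obtain x where x: "x \<in> C" using * by blast
  have "(\<lambda>n. inverse (real (Suc n)) *\<^sub>R x) \<longlonglongrightarrow> 0 *\<^sub>R x"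
    by (intro tendsto_scaleR LIMSEQ_inverse_real_of_nat tendsto_const)
  moreover have "inverse (real (Suc n)) *\<^sub>R x \<in> C" for n
    by (rule scale[OF x]) simp
  ultimately have zero: "0 \<in> C"
    using closed_sequentially[OF assms] by fastforce
  have "c *\<^sub>R x \<in> C" if "x \<in> C" "c \<ge> 0" for c x
    using scale[OF that(1)] zero that(2) by (cases "c = 0") auto
  with zero add show "convex_cone C"
    by (auto simp: convex_cone_iff)
qed

definition polar_cone :: "'a::real_inner set \<Rightarrow> 'a set" where
  "polar_cone C = {y. \<forall>x\<in>C. y \<bullet> x \<le> 0}"

text \<open>The standard normal law N(0, I) on R^d with d = CARD('n).\<close>

definition std_gaussian :: "(real ^ 'n) measure" where
  "std_gaussian = density lborel (\<lambda>x. ennreal (\<Prod>i\<in>UNIV. std_normal_density (x $ i)))"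

text \<open>The chi-squared law with j degrees of freedom, as the law of the sum of squares of j independent
  standard normal variables. For j = 0 the sum is empty, giving the point mass at 0.\<close>

definition chi_squared :: "nat \<Rightarrow> real measure" where
  "chi_squared j =
     distr (Pi\<^sub>M {..<j} (\<lambda>_. std_normal_distribution)) borel (\<lambda>x. \<Sum>i<j. (x i)\<^sup>2)"

text \<open>\<open>intrinsic_volumes C w\<close>: the numbers w 0, ..., w d are the conic intrinsic volumes of C.
  They are characterised by their defining property; that exactly one such family (w 0, ..., w d)
  exists for each closed convex cone is the background fact that justifies the name. The test function f
  is taken on all of R x R; only its values on the nonnegative quadrant matter. The product measure
  is the joint law of the independent pair (Y_j, Y'_(d-j)).\<close>

definition intrinsic_volumes :: "(real ^ 'n) set \<Rightarrow> (nat \<Rightarrow> real) \<Rightarrow> bool" where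
  "intrinsic_volumes C w \<longleftrightarrow>
     (\<forall>j\<le>CARD('n). 0 \<le> w j) \<and>
     (\<Sum>j\<le>CARD('n). w j) = 1 \<and>
     (\<forall>f :: real \<times> real \<Rightarrow> real. f \<in> borel_measurable borel \<longrightarrow> bounded (range f) \<longrightarrow>
        (\<integral>x. f ((norm (closest_point C x))\<^sup>2, (norm (closest_point (polar_cone C) x))\<^sup>2) \<partial>std_gaussian) =
        (\<Sum>j\<le>CARD('n). w j * (\<integral>y. f y \<partial>(chi_squared j \<Otimes>\<^sub>M chi_squared (CARD('n) - j)))))"

definition statistical_dimension :: "(real ^ 'n) set \<Rightarrow> real" where
  "statistical_dimension C = (\<integral>x. (norm (closest_point C x))\<^sup>2 \<partial>std_gaussian)"

end

theory Submission
  imports Defs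
begin

text \<open>Let \<open>P\<close> be the projection onto \<open>C\<close>, let \<open>F x = (norm (P x))\<^sup>2\<close>, and let \<open>(A, B)\<close> be a pair of
  standard Gaussian vectors with correlation \<open>s\<close>, that is, \<open>B = s A + sqrt (1 - s\<^sup>2) A'\<close> with an
  independent copy \<open>A'\<close> of \<open>A\<close>. Everything is read off from
  \<open>K s = E (P A \<bullet> P B)\<close>, which runs from \<open>K 0 = v\<close> to \<open>K 1 = \<delta>\<close>, the statistical dimension, and from
  \<open>\<Phi> s = E (F A * F B)\<close>, for which \<open>\<Phi> 1 - \<Phi> 0\<close> is the variance of \<open>F\<close>.

  The defining property of the intrinsic volumes says that \<open>F\<close> is a chi-squared variable with a random
  number \<open>V\<close> of degrees of freedom, so the first two chi-squared moments give \<open>E V = \<delta>\<close> and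
  \<open>Var V = Var F - 2 \<delta>\<close> (\<open>intrinsic_volumes_moments\<close>). Since \<open>F\<close> has gradient \<open>2 P\<close>, the
  Gaussian covariance identity is \<open>\<Phi>' = 4 K\<close>, whence
  \<open>Var V\<close> is four times the integral of \<open>K s - s \<delta>\<close> over the unit interval. It remains to bound \<open>K\<close>:

  \<^item> \<open>K s \<le> (1 - s) v + s \<delta>\<close>, because correlation \<open>s\<close> between Gaussian vectors damps the centred part of
    \<open>P\<close> by at least the factor \<open>s\<close> (Gebelein's inequality, \<open>noise_stability_bounds\<close>). Integration
    gives \<open>Var V \<le> 2 v\<close>.
  \<^item> \<open>v \<le> K s\<close>, from the same lemma, and \<open>s \<delta> \<le> K s\<close>, because \<open>c \<bullet> x \<le> c \<bullet> P x\<close> for \<open>c \<in> C\<close>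
    (\<open>noise_stability_closest_point_cone_ge\<close>). Using the first bound below \<open>s = v / \<delta>\<close> and the second
    above gives \<open>Var V \<ge> 2 v\<^sup>2 / \<delta>\<close>. As \<open>\<delta>\<close> is at most the dimension, \<open>b \<ge> \<delta> / 2\<close>, and the lower
    bound \<open>v\<^sup>2 / b\<close> follows.

  The identity \<open>\<Phi>' = 4 K\<close> is obtained from finite differences
  (\<open>noise_stability_step\<close>): the correlation grows from \<open>a\<^sup>2 s\<close> to \<open>a\<^sup>2 s + b\<^sup>2\<close>, where
  \<open>a\<^sup>2 + b\<^sup>2 = 1\<close>, when the independent noises \<open>b Z\<close> and \<open>b Z'\<close> added to \<open>a A\<close> and \<open>a B\<close> are replaced by
  one common noise, and the first-order expansion of \<open>F\<close> shows that this adds \<open>b\<^sup>2 E (\<nabla>F (a A) \<bullet> \<nabla>F (a B))\<close>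
  up to \<open>O (b ^ 3)\<close>. Errors of that order vanish when many small steps are summed. Gebelein's
  inequality follows from the positivity of a square, from the semigroup property, and from
  \<open>K s - K 0 = O (s)\<close>.\<close>

section \<open>Moments of the standard Gaussian law\<close>

lemma nn_integral_std_gaussian_prod:
  fixes h :: "'n::finite \<Rightarrow> real \<Rightarrow> ennreal"
  assumes [measurable]: "\<And>i. h i \<in> borel_measurable borel"
  shows "(\<integral>\<^sup>+x. (\<Prod>i\<in>UNIV. h i (x $ i)) \<partial>(std_gaussian :: (real^'n) measure))
    = (\<Prod>i\<in>UNIV. \<integral>\<^sup>+t. h i t \<partial>std_normal_distribution)"
proof -
  define q where "q b t = ennreal (std_normal_density t) * h (axis_index b) t" for b :: "real^'n" and t
  have [measurable]: "q b \<in> borel_measurable borel" for b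
    unfolding q_def by measurable
  have basis: "(\<Prod>b\<in>(Basis :: (real^'n) set). p b) = (\<Prod>i\<in>UNIV. p (axis i 1))" for p :: "real^'n \<Rightarrow> ennreal"
  proof -
    have "(Basis :: (real^'n) set) = range (\<lambda>i. axis i 1)" by (auto simp: Basis_vec_def)
    moreover have "inj (\<lambda>i::'n. axis i (1::real))" by (auto simp: inj_on_def axis_eq_axis)
    ultimately show ?thesis
      using prod.reindex[of "\<lambda>i::'n. axis i (1::real)" UNIV p] by (metis (no_types, lifting) comp_apply prod.cong)
  qed
  have "(\<integral>\<^sup>+x. (\<Prod>i\<in>UNIV. h i (x $ i)) \<partial>(std_gaussian :: (real^'n) measure))
     = (\<integral>\<^sup>+x. (\<Prod>b\<in>Basis. q b (x \<bullet> b)) \<partial>lborel)"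
    unfolding std_gaussian_def
    by (subst nn_integral_density)
       (auto simp: basis q_def prod.distrib prod_ennreal inner_axis axis_index_axis
             intro!: nn_integral_cong)
  also have "\<dots> = (\<Prod>b\<in>Basis. \<integral>\<^sup>+t. q b t \<partial>lborel)"
    by (rule nn_integral_lborel_prod) auto
  also have "\<dots> = (\<Prod>i\<in>UNIV. \<integral>\<^sup>+t. h i t \<partial>std_normal_distribution)"
    by (simp add: basis q_def axis_index_axis nn_integral_density)
  finally show ?thesis .
qed

lemma prob_space_std_normal: "prob_space std_normal_distribution"
  by (rule prob_space_normal_density) simp

lemma sets_std_gaussian [simp, measurable_cong]: "sets std_gaussian = sets borel"
  by (simp add: std_gaussian_def)

lemma space_std_gaussian [simp]: "space std_gaussian = UNIV"
  by (simp add: std_gaussian_def)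

lemma prob_space_std_gaussian: "prob_space (std_gaussian :: (real^'n) measure)"
proof
  interpret N: prob_space std_normal_distribution by (rule prob_space_std_normal)
  have "emeasure (std_gaussian :: (real^'n) measure) UNIV
      = (\<integral>\<^sup>+x. (\<Prod>i\<in>UNIV. (\<lambda>_ _. 1) i (x $ i)) \<partial>(std_gaussian :: (real^'n) measure))"
    by simp
  also have "\<dots> = 1"
    by (subst nn_integral_std_gaussian_prod) (use N.emeasure_space_1 in auto)
  finally show "emeasure (std_gaussian :: (real^'n) measure) (space std_gaussian) = 1"
    by simp
qed

lemma distr_std_gaussian_nth:
  "distr (std_gaussian :: (real^'n) measure) borel (\<lambda>x. x $ i) = std_normal_distribution"
proof (rule measure_eqI)
  interpret N: prob_space std_normal_distribution by (rule prob_space_std_normal)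
  fix X assume "X \<in> sets (distr (std_gaussian :: (real^'n) measure) borel (\<lambda>x. x $ i))"
  then have [measurable]: "X \<in> sets borel" by simp
  define h where "h k t = (if k = i then indicator X t else (1::ennreal))" for k :: 'n and t :: real
  have [measurable]: "h k \<in> borel_measurable borel" for k
    unfolding h_def by (cases "k = i") auto
  have "(\<Prod>k\<in>UNIV. h k (x $ k)) = indicator X (x $ i)" for x :: "real^'n"
    by (simp add: h_def prod.delta)
  moreover have "emeasure (distr (std_gaussian :: (real^'n) measure) borel (\<lambda>x. x $ i)) X
      = (\<integral>\<^sup>+t. indicator X t \<partial>distr (std_gaussian :: (real^'n) measure) borel (\<lambda>x. x $ i))"
    by simp
  ultimately have "emeasure (distr (std_gaussian :: (real^'n) measure) borel (\<lambda>x. x $ i)) X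
      = (\<integral>\<^sup>+x. (\<Prod>k\<in>UNIV. h k (x $ k)) \<partial>(std_gaussian :: (real^'n) measure))"
    by (subst (asm) nn_integral_distr) auto
  also have "\<dots> = (\<Prod>k\<in>UNIV. \<integral>\<^sup>+t. h k t \<partial>std_normal_distribution)"
    by (rule nn_integral_std_gaussian_prod) auto
  also have "\<dots> = (\<Prod>k\<in>UNIV. if k = i then emeasure std_normal_distribution X else 1)"
  proof (rule prod.cong[OF refl])
    fix k :: 'n
    show "(\<integral>\<^sup>+t. h k t \<partial>std_normal_distribution)
        = (if k = i then emeasure std_normal_distribution X else 1)"
      using N.emeasure_space_1 by (cases "k = i") (simp_all add: h_def)
  qed
  also have "\<dots> = emeasure std_normal_distribution X"
    by (simp add: prod.delta)
  finally show "emeasure (distr (std_gaussian :: (real^'n) measure) borel (\<lambda>x. x $ i)) X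
      = emeasure std_normal_distribution X" .
qed simp

lemma std_normal_moments:
  "integrable std_normal_distribution (\<lambda>t. t ^ k)"
  "(\<integral>t. t\<^sup>2 \<partial>std_normal_distribution) = 1"
  "(\<integral>t. t ^ 4 \<partial>std_normal_distribution) = 3"
proof -
  have "integrable lborel (\<lambda>x. std_normal_density x * x ^ k)"
    by (rule integrable_std_normal_moment)
  then show "integrable std_normal_distribution (\<lambda>t. t ^ k)"
    by (subst integrable_density) auto
  show "(\<integral>t. t\<^sup>2 \<partial>std_normal_distribution) = 1"
    using integral_std_normal_moment_even[of 1] by (subst integral_density) auto
  show "(\<integral>t. t ^ 4 \<partial>std_normal_distribution) = 3"
    using integral_std_normal_moment_even[of 2]
    by (subst integral_density) (auto simp: fact_numeral)
qed

lemma std_gaussian_nth_moments: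
  fixes i :: "'n::finite"
  shows "integrable (std_gaussian :: (real^'n) measure) (\<lambda>x. (x $ i) ^ k)"
    and "(\<integral>x. (x $ i)\<^sup>2 \<partial>(std_gaussian :: (real^'n) measure)) = 1"
proof -
  have "integrable (distr (std_gaussian :: (real^'n) measure) borel (\<lambda>x. x $ i)) (\<lambda>t. t ^ k)"
    unfolding distr_std_gaussian_nth by (rule std_normal_moments)
  then show "integrable (std_gaussian :: (real^'n) measure) (\<lambda>x. (x $ i) ^ k)"
    by (subst (asm) integrable_distr_eq) auto
  have "(\<integral>t. t\<^sup>2 \<partial>distr (std_gaussian :: (real^'n) measure) borel (\<lambda>x. x $ i)) = 1"
    unfolding distr_std_gaussian_nth by (rule std_normal_moments)
  then show "(\<integral>x. (x $ i)\<^sup>2 \<partial>(std_gaussian :: (real^'n) measure)) = 1"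
    by (subst (asm) integral_distr) auto
qed

text \<open>Fourth moments suffice, since all functions below grow at most quadratically and only
  products of two of them occur.\<close>

lemma integrable_std_gaussian_norm_power:
  assumes "k \<le> 4"
  shows "integrable (std_gaussian :: (real^'n) measure) (\<lambda>x. norm x ^ k)"
proof (rule Bochner_Integration.integrable_bound)
  show "integrable (std_gaussian :: (real^'n) measure)
      (\<lambda>x. 1 + real CARD('n) * (\<Sum>i\<in>UNIV. (x $ i) ^ 4))"
    using prob_space_std_gaussian[where 'n='n]
    by (intro Bochner_Integration.integrable_add integrable_mult_right Bochner_Integration.integrable_sum
        std_gaussian_nth_moments) (simp add: prob_space.finite_measure finite_measure.integrable_const)
  show "AE x in (std_gaussian :: (real^'n) measure).
      norm (norm x ^ k) \<le> norm (1 + real CARD('n) * (\<Sum>i\<in>UNIV. (x $ i) ^ 4))"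
  proof (rule AE_I2)
    fix x :: "real^'n"
    have "norm x ^ 4 = (\<Sum>i\<in>UNIV. (x $ i)\<^sup>2)\<^sup>2"
      unfolding norm_vec_def L2_set_def
      by (simp add: power4_eq_xxxx power2_eq_square sum_nonneg)
    also have "\<dots> = (\<Sum>i\<in>UNIV. \<Sum>j\<in>UNIV. (x $ i)\<^sup>2 * (x $ j)\<^sup>2)"
      by (simp add: power2_eq_square sum_product)
    also have "\<dots> \<le> (\<Sum>i\<in>UNIV. \<Sum>j\<in>(UNIV::'n set). ((x $ i) ^ 4 + (x $ j) ^ 4) / 2)"
    proof (intro sum_mono)
      fix i j
      show "(x $ i)\<^sup>2 * (x $ j)\<^sup>2 \<le> ((x $ i) ^ 4 + (x $ j) ^ 4) / 2"
        using sum_squares_bound[of "(x $ i)\<^sup>2" "(x $ j)\<^sup>2"] by (simp flip: power_mult)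
    qed
    also have "\<dots> = real CARD('n) * (\<Sum>i\<in>UNIV. (x $ i) ^ 4)"
      by (simp add: sum.distrib add_divide_distrib flip: sum_divide_distrib sum_distrib_left)
    finally have 4: "norm x ^ 4 \<le> real CARD('n) * (\<Sum>i\<in>UNIV. (x $ i) ^ 4)" .
    have "norm x ^ k \<le> 1 + norm x ^ 4"
    proof (cases "norm x \<le> 1")
      case True
      then have "norm x ^ k \<le> 1" by (simp add: power_le_one)
      then show ?thesis by (smt (verit) zero_le_power norm_ge_zero)
    next
      case False
      then have "norm x ^ k \<le> norm x ^ 4" using assms by (intro power_increasing) auto
      then show ?thesis by simp
    qed
    with 4 show "norm (norm x ^ k) \<le> norm (1 + real CARD('n) * (\<Sum>i\<in>UNIV. (x $ i) ^ 4))"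
      by (simp add: sum_nonneg)
  qed
qed simp

text \<open>Sign changes of one coordinate preserve the law; hence means and mixed second moments vanish.\<close>

lemma distr_std_gaussian_flip:
  fixes i :: "'n::finite"
  shows "distr (std_gaussian :: (real^'n) measure) borel (\<lambda>x. \<chi> k. if k = i then - (x $ k) else x $ k) = std_gaussian"
proof (rule measure_eqI)
  define T where "T x = (\<chi> k. if k = i then - (x $ k) else x $ k)" for x :: "real^'n"
  define c where "c b = (if b = axis i 1 then -1 else 1 :: real)" for b :: "real^'n"
  have T_eq: "T x = (\<Sum>b\<in>Basis. (c b * (x \<bullet> b)) *\<^sub>R b)" for x
  proof (rule euclidean_eqI)
    fix b :: "real^'n" assume b: "b \<in> Basis"
    then obtain k where k: "b = axis k 1" by (auto simp: Basis_vec_def)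
    then have "T x \<bullet> b = c b * (x \<bullet> b)"
      by (simp add: T_def c_def inner_axis axis_eq_axis)
    then show "T x \<bullet> b = (\<Sum>b\<in>Basis. (c b * (x \<bullet> b)) *\<^sub>R b) \<bullet> b"
      using b by simp
  qed
  have Tm [measurable]: "T \<in> borel_measurable borel"
    unfolding T_eq[abs_def] by measurable
  have abs_c: "\<bar>c b\<bar> = 1" for b by (simp add: c_def)
  have "(lborel :: (real^'n) measure) = density (distr lborel borel T) (\<lambda>_. (\<Prod>j\<in>Basis. \<bar>c j\<bar>))"
    using lborel_affine_euclidean[where c = c and t = 0] abs_c
    by (simp add: T_eq[abs_def] c_def)
  then have T: "distr lborel borel T = (lborel :: (real^'n) measure)"
    by (simp add: abs_c density_1)
  have nth: "(\<Prod>k\<in>UNIV. std_normal_density (T x $ k)) = (\<Prod>k\<in>UNIV. std_normal_density (x $ k))" for x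
    by (intro prod.cong) (auto simp: T_def std_normal_density_def)
  fix X assume "X \<in> sets (distr (std_gaussian :: (real^'n) measure) borel T)"
  then have [measurable]: "X \<in> sets borel" by simp
  define \<phi> where "\<phi> x = ennreal (\<Prod>k\<in>UNIV. std_normal_density (x $ k))" for x :: "real^'n"
  have [measurable]: "\<phi> \<in> borel_measurable borel" unfolding \<phi>_def by measurable
  have "emeasure (distr std_gaussian borel T) X = (\<integral>\<^sup>+x. indicator X x \<partial>distr std_gaussian borel T)" by simp
  also have "\<dots> = (\<integral>\<^sup>+x. indicator X (T x) \<partial>std_gaussian)"
    by (subst nn_integral_distr) auto
  also have "\<dots> = (\<integral>\<^sup>+x. \<phi> (T x) * indicator X (T x) \<partial>lborel)"
    unfolding std_gaussian_def by (subst nn_integral_density) (auto simp: nth \<phi>_def)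
  also have "\<dots> = (\<integral>\<^sup>+x. \<phi> x * indicator X x \<partial>distr lborel borel T)"
    by (subst nn_integral_distr) auto
  also have "\<dots> = (\<integral>\<^sup>+x. indicator X x \<partial>std_gaussian)"
    unfolding T std_gaussian_def by (subst nn_integral_density) (auto simp: \<phi>_def)
  finally show "emeasure (distr std_gaussian borel T) X = emeasure (std_gaussian :: (real^'n) measure) X"
    by simp
qed simp

lemma integral_std_gaussian_nth_mult:
  fixes i j :: "'n::finite"
  shows "(\<integral>x. x $ i * x $ j \<partial>(std_gaussian :: (real^'n) measure)) = (if i = j then 1 else 0)"
    and "(\<integral>x. x $ i \<partial>(std_gaussian :: (real^'n) measure)) = 0"
proof -
  have [measurable]: "(\<lambda>x. \<chi> k. if k = i then - (x $ k) else x $ k) \<in> borel_measurable (borel :: (real^'n) measure)"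
  proof (intro borel_measurable_continuous_onI continuous_on_vec_lambda)
    show "continuous_on UNIV (\<lambda>x::real^'n. if k = i then - (x $ k) else x $ k)" for k
      by (cases "k = i") (auto intro!: continuous_intros)
  qed
  have flip: "(\<integral>x. h x \<partial>std_gaussian) = (\<integral>x. h (\<chi> k. if k = i then - (x $ k) else x $ k) \<partial>std_gaussian)"
    if [measurable]: "h \<in> borel_measurable borel" for h :: "real^'n \<Rightarrow> real"
    by (subst distr_std_gaussian_flip[of i, symmetric], subst integral_distr) auto
  show "(\<integral>x. x $ i \<partial>(std_gaussian :: (real^'n) measure)) = 0"
    using flip[of "\<lambda>x. x $ i"] by simp
  show "(\<integral>x. x $ i * x $ j \<partial>(std_gaussian :: (real^'n) measure)) = (if i = j then 1 else 0)"
  proof (cases "i = j")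
    case True
    then show ?thesis
      using std_gaussian_nth_moments(2)[of i] by (simp add: power2_eq_square)
  next
    case False
    then show ?thesis using flip[of "\<lambda>x. x $ i * x $ j"] by simp
  qed
qed

lemma integrable_std_gaussian_nth_mult:
  fixes i j :: "'n::finite"
  shows "integrable (std_gaussian :: (real^'n) measure) (\<lambda>x. x $ i * x $ j)"
proof (rule Bochner_Integration.integrable_bound)
  show "integrable (std_gaussian :: (real^'n) measure) (\<lambda>x. norm x ^ 2)"
    by (rule integrable_std_gaussian_norm_power) simp
  show "AE x in (std_gaussian :: (real^'n) measure). norm (x $ i * x $ j) \<le> norm (norm x ^ 2)"
  proof (rule AE_I2)
    fix x :: "real^'n"
    show "norm (x $ i * x $ j) \<le> norm (norm x ^ 2)"
      using mult_mono[OF component_le_norm_cart[of x i] component_le_norm_cart[of x j]]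
      by (simp add: abs_mult power2_eq_square)
  qed
qed simp

lemma integral_std_gaussian_inner_mult:
  fixes u w :: "real^'n"
  shows "(\<integral>x. (u \<bullet> x) * (w \<bullet> x) \<partial>std_gaussian) = u \<bullet> w"
proof -
  have "(\<integral>x. (u \<bullet> x) * (w \<bullet> x) \<partial>std_gaussian)
      = (\<integral>x. (\<Sum>i\<in>UNIV. \<Sum>j\<in>UNIV. (u $ i * w $ j) * (x $ i * x $ j)) \<partial>std_gaussian)"
    by (simp add: inner_vec_def sum_product mult_ac)
  also have "\<dots> = (\<Sum>i\<in>UNIV. \<Sum>j\<in>UNIV. (u $ i * w $ j) * (\<integral>x. x $ i * x $ j \<partial>(std_gaussian :: (real^'n) measure)))"
    by (simp add: integrable_std_gaussian_nth_mult Bochner_Integration.integral_sum Bochner_Integration.integrable_sum)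
  also have "\<dots> = u \<bullet> w"
    by (simp add: integral_std_gaussian_nth_mult inner_vec_def if_distrib[of "(*) _"] sum.delta cong: if_cong)
  finally show ?thesis .
qed

lemma integral_std_gaussian_inner:
  fixes u :: "real^'n"
  shows "(\<integral>x. u \<bullet> x \<partial>std_gaussian) = 0"
proof -
  have "integrable (std_gaussian :: (real^'n) measure) (\<lambda>x. x $ i)" for i
    using std_gaussian_nth_moments(1)[of i 1] by simp
  then show ?thesis
    by (simp add: inner_vec_def integral_std_gaussian_nth_mult(2) Bochner_Integration.integral_sum)
qed

section \<open>Rotation invariance\<close>

lemma nn_integral_lborel_plus:
  fixes c :: "'a::euclidean_space"
  assumes [measurable]: "f \<in> borel_measurable borel"
  shows "(\<integral>\<^sup>+x. f (x + c) \<partial>lborel) = (\<integral>\<^sup>+x. f x \<partial>lborel)"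
proof -
  have "(\<integral>\<^sup>+x. f x \<partial>distr lborel borel ((+) c)) = (\<integral>\<^sup>+x. f (c + x) \<partial>lborel)"
    by (rule nn_integral_distr) auto
  then show ?thesis by (simp add: lborel_distr_plus add.commute)
qed

lemma nn_integral_shear1:
  fixes f :: "'a::euclidean_space \<times> 'a \<Rightarrow> ennreal"
  assumes [measurable]: "f \<in> borel_measurable borel"
  shows "(\<integral>\<^sup>+p. f (fst p + t *\<^sub>R snd p, snd p) \<partial>(lborel \<Otimes>\<^sub>M lborel)) = (\<integral>\<^sup>+p. f p \<partial>(lborel \<Otimes>\<^sub>M lborel))"
proof -
  have [measurable]: "f \<in> borel_measurable (borel \<Otimes>\<^sub>M borel)" by (simp add: borel_prod)
  have "(\<integral>\<^sup>+p. f (fst p + t *\<^sub>R snd p, snd p) \<partial>(lborel \<Otimes>\<^sub>M lborel))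
     = (\<integral>\<^sup>+y. \<integral>\<^sup>+x. f (x + t *\<^sub>R y, y) \<partial>lborel \<partial>lborel)"
    by (subst lborel_pair.nn_integral_snd[symmetric]) auto
  also have "\<dots> = (\<integral>\<^sup>+y. \<integral>\<^sup>+x. f (x, y) \<partial>lborel \<partial>lborel)"
    by (intro nn_integral_cong nn_integral_lborel_plus[where f = "\<lambda>x. f (x, _)"]) auto
  also have "\<dots> = (\<integral>\<^sup>+p. f p \<partial>(lborel \<Otimes>\<^sub>M lborel))"
    by (rule lborel_pair.nn_integral_snd) auto
  finally show ?thesis .
qed

lemma nn_integral_shear2:
  fixes f :: "'a::euclidean_space \<times> 'a \<Rightarrow> ennreal"
  assumes [measurable]: "f \<in> borel_measurable borel"
  shows "(\<integral>\<^sup>+p. f (fst p, snd p + t *\<^sub>R fst p) \<partial>(lborel \<Otimes>\<^sub>M lborel)) = (\<integral>\<^sup>+p. f p \<partial>(lborel \<Otimes>\<^sub>M lborel))"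
proof -
  have [measurable]: "f \<in> borel_measurable (borel \<Otimes>\<^sub>M borel)" by (simp add: borel_prod)
  have "(\<integral>\<^sup>+p. f (fst p, snd p + t *\<^sub>R fst p) \<partial>(lborel \<Otimes>\<^sub>M lborel))
     = (\<integral>\<^sup>+x. \<integral>\<^sup>+y. f (x, y + t *\<^sub>R x) \<partial>lborel \<partial>lborel)"
    by (subst lborel.nn_integral_fst[symmetric]) auto
  also have "\<dots> = (\<integral>\<^sup>+x. \<integral>\<^sup>+y. f (x, y) \<partial>lborel \<partial>lborel)"
    by (intro nn_integral_cong nn_integral_lborel_plus[where f = "\<lambda>y. f (_, y)"]) auto
  also have "\<dots> = (\<integral>\<^sup>+p. f p \<partial>(lborel \<Otimes>\<^sub>M lborel))"
    by (rule lborel.nn_integral_fst) auto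
  finally show ?thesis .
qed

text \<open>A plane rotation is a product of three shears, and each shear preserves Lebesgue measure by
  Fubini and translation invariance. The condition \<open>0 \<le> a\<close> keeps the angle away from
  \<open>\<pi>\<close>, where the shears degenerate.\<close>

lemma nn_integral_lborel_rotation:
  fixes f :: "'a::euclidean_space \<times> 'a \<Rightarrow> ennreal"
  assumes [measurable]: "f \<in> borel_measurable borel" and "0 \<le> a" and "a\<^sup>2 + b\<^sup>2 = 1"
  shows "(\<integral>\<^sup>+p. f (a *\<^sub>R fst p + b *\<^sub>R snd p, a *\<^sub>R snd p - b *\<^sub>R fst p) \<partial>(lborel \<Otimes>\<^sub>M lborel))
    = (\<integral>\<^sup>+p. f p \<partial>(lborel \<Otimes>\<^sub>M lborel))"
proof -
  \<comment> \<open>The tangent of half the rotation angle, whose cosine and sine are \<open>a\<close> and \<open>b\<close>.\<close>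
  define t where "t = b / (1 + a)"
  have t: "1 - b * t = a" "t * (1 + a) = b"
    using assms(2,3) by (auto simp: t_def field_simps power2_eq_square)
  have 1: "(fst p + t *\<^sub>R snd p) + t *\<^sub>R (a *\<^sub>R snd p - b *\<^sub>R fst p) = a *\<^sub>R fst p + b *\<^sub>R snd p"
    and 2: "snd p + (- b) *\<^sub>R (fst p + t *\<^sub>R snd p) = a *\<^sub>R snd p - b *\<^sub>R fst p" for p :: "'a \<times> 'a"
  proof -
    have "snd p + (- b) *\<^sub>R (fst p + t *\<^sub>R snd p) = (1 - b * t) *\<^sub>R snd p - b *\<^sub>R fst p"
      by (simp add: algebra_simps)
    then show "snd p + (- b) *\<^sub>R (fst p + t *\<^sub>R snd p) = a *\<^sub>R snd p - b *\<^sub>R fst p"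
      by (simp add: t)
    have "(fst p + t *\<^sub>R snd p) + t *\<^sub>R (a *\<^sub>R snd p - b *\<^sub>R fst p) = (1 - b * t) *\<^sub>R fst p + (t * (1 + a)) *\<^sub>R snd p"
      by (simp add: algebra_simps)
    then show "(fst p + t *\<^sub>R snd p) + t *\<^sub>R (a *\<^sub>R snd p - b *\<^sub>R fst p) = a *\<^sub>R fst p + b *\<^sub>R snd p"
      by (simp only: t)
  qed
  have "(\<integral>\<^sup>+p. f p \<partial>(lborel \<Otimes>\<^sub>M lborel)) = (\<integral>\<^sup>+p. f (fst p + t *\<^sub>R snd p, snd p) \<partial>(lborel \<Otimes>\<^sub>M lborel))"
    by (rule nn_integral_shear1[symmetric]) auto
  also have "\<dots> = (\<integral>\<^sup>+p. f (fst p + t *\<^sub>R (snd p + (- b) *\<^sub>R fst p), snd p + (- b) *\<^sub>R fst p) \<partial>(lborel \<Otimes>\<^sub>M lborel))"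
    by (subst nn_integral_shear2[symmetric, where t = "- b"])
       (simp_all add: measurable_compose[OF borel_measurable_continuous_onI assms(1)] continuous_intros)
  also have "\<dots> = (\<integral>\<^sup>+p. f ((fst p + t *\<^sub>R snd p) + t *\<^sub>R (snd p + (- b) *\<^sub>R (fst p + t *\<^sub>R snd p)),
       snd p + (- b) *\<^sub>R (fst p + t *\<^sub>R snd p)) \<partial>(lborel \<Otimes>\<^sub>M lborel))"
    by (subst nn_integral_shear1[symmetric, where t = t])
       (simp_all add: measurable_compose[OF borel_measurable_continuous_onI assms(1)] continuous_intros)
  finally show ?thesis unfolding 2 1 by simp
qed

lemma std_gaussian_density_eq:
  fixes x :: "real^'n"
  shows "(\<Prod>i\<in>UNIV. std_normal_density (x $ i)) = (1 / sqrt (2 * pi)) ^ CARD('n) * exp (- ((norm x)\<^sup>2 / 2))"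
proof -
  have "(\<Prod>i\<in>UNIV. std_normal_density (x $ i))
      = (1 / sqrt (2 * pi)) ^ CARD('n) * exp (\<Sum>i\<in>UNIV. - (x $ i)\<^sup>2 / 2)"
    by (simp add: std_normal_density_def prod.distrib exp_sum power_divide prod_dividef)
  also have "(\<Sum>i\<in>UNIV. - (x $ i)\<^sup>2 / 2) = - ((norm x)\<^sup>2 / 2)"
    by (simp add: norm_vec_def L2_set_def sum_nonneg sum_negf flip: sum_divide_distrib)
  finally show ?thesis .
qed

lemma nn_integral_std_gaussian_rotation:
  fixes f :: "(real^'n) \<times> (real^'n) \<Rightarrow> ennreal"
  assumes [measurable]: "f \<in> borel_measurable borel" and "0 \<le> a" and ab: "a\<^sup>2 + b\<^sup>2 = 1"
  shows "(\<integral>\<^sup>+x. \<integral>\<^sup>+y. f (a *\<^sub>R x + b *\<^sub>R y, a *\<^sub>R y - b *\<^sub>R x) \<partial>std_gaussian \<partial>std_gaussian)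
    = (\<integral>\<^sup>+x. \<integral>\<^sup>+y. f (x, y) \<partial>std_gaussian \<partial>std_gaussian)"
proof -
  define c where "c = (1 / sqrt (2 * pi)) ^ CARD('n)"
  define r where "r p = ennreal (c * exp (- ((norm (fst p))\<^sup>2 + (norm (snd p))\<^sup>2) / 2) * c)" for p :: "(real^'n) \<times> (real^'n)"
  have c: "c \<ge> 0" by (simp add: c_def)
  have [measurable]: "r \<in> borel_measurable borel"
    unfolding r_def borel_prod[symmetric] by measurable
  have iter: "(\<integral>\<^sup>+x. \<integral>\<^sup>+y. h (x, y) \<partial>std_gaussian \<partial>std_gaussian) = (\<integral>\<^sup>+p. r p * h p \<partial>(lborel \<Otimes>\<^sub>M lborel))"
    if [measurable]: "h \<in> borel_measurable borel" for h :: "(real^'n) \<times> (real^'n) \<Rightarrow> ennreal"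
  proof -
    have [measurable]: "h \<in> borel_measurable (borel \<Otimes>\<^sub>M borel)" "r \<in> borel_measurable (borel \<Otimes>\<^sub>M borel)"
      by (simp_all add: borel_prod)
    have [simp]: "ennreal (c * exp (- ((norm x)\<^sup>2 / 2))) * (ennreal (c * exp (- ((norm y)\<^sup>2 / 2))) * z) = r (x, y) * z"
      for x y :: "real^'n" and z :: ennreal
    proof -
      have "exp (- ((norm x)\<^sup>2 + (norm y)\<^sup>2) / 2) = exp (- ((norm x)\<^sup>2 / 2)) * exp (- ((norm y)\<^sup>2 / 2))"
        by (simp add: field_simps flip: exp_add)
      then have "r (x, y) = ennreal (c * exp (- ((norm x)\<^sup>2 / 2))) * ennreal (c * exp (- ((norm y)\<^sup>2 / 2)))"
        unfolding r_def using c by (simp add: mult_ac flip: ennreal_mult)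
      then show ?thesis by (simp add: mult.assoc)
    qed
    interpret G: prob_space "std_gaussian :: (real^'n) measure" by (rule prob_space_std_gaussian)
    have "(\<integral>\<^sup>+x. \<integral>\<^sup>+y. h (x, y) \<partial>std_gaussian \<partial>std_gaussian)
       = (\<integral>\<^sup>+x. ennreal (c * exp (- ((norm x)\<^sup>2 / 2))) * (\<integral>\<^sup>+y. h (x, y) \<partial>std_gaussian) \<partial>lborel)"
      by (subst std_gaussian_def) (simp add: std_gaussian_density_eq nn_integral_density flip: c_def)
    also have "\<dots> = (\<integral>\<^sup>+x. \<integral>\<^sup>+y. r (x, y) * h (x, y) \<partial>lborel \<partial>lborel)"
      by (subst std_gaussian_def)
         (simp add: std_gaussian_density_eq nn_integral_density nn_integral_cmult[symmetric] flip: c_def)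
    also have "\<dots> = (\<integral>\<^sup>+p. r p * h p \<partial>(lborel \<Otimes>\<^sub>M lborel))"
      by (rule lborel.nn_integral_fst) auto
    finally show ?thesis .
  qed
  have n: "(norm (a *\<^sub>R x + b *\<^sub>R y))\<^sup>2 + (norm (a *\<^sub>R y - b *\<^sub>R x))\<^sup>2 = (norm x)\<^sup>2 + (norm y)\<^sup>2" for x y :: "real^'n"
  proof -
    have "(norm (a *\<^sub>R x + b *\<^sub>R y))\<^sup>2 + (norm (a *\<^sub>R y - b *\<^sub>R x))\<^sup>2 = (a\<^sup>2 + b\<^sup>2) * ((norm x)\<^sup>2 + (norm y)\<^sup>2)"
      unfolding power2_norm_eq_inner
      by (simp add: inner_simps algebra_simps power2_eq_square inner_commute)
    then show ?thesis by (simp add: ab)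
  qed
  have r: "r (a *\<^sub>R fst p + b *\<^sub>R snd p, a *\<^sub>R snd p - b *\<^sub>R fst p) = r p" for p
    by (simp add: r_def n)
  have [measurable]: "(\<lambda>p. f (a *\<^sub>R fst p + b *\<^sub>R snd p, a *\<^sub>R snd p - b *\<^sub>R fst p)) \<in> borel_measurable borel"
    by (rule measurable_compose[OF _ assms(1)]) (intro borel_measurable_continuous_onI continuous_intros)
  have "(\<integral>\<^sup>+x. \<integral>\<^sup>+y. f (a *\<^sub>R x + b *\<^sub>R y, a *\<^sub>R y - b *\<^sub>R x) \<partial>std_gaussian \<partial>std_gaussian)
     = (\<integral>\<^sup>+p. r p * f (a *\<^sub>R fst p + b *\<^sub>R snd p, a *\<^sub>R snd p - b *\<^sub>R fst p) \<partial>(lborel \<Otimes>\<^sub>M lborel))"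
    using iter[of "\<lambda>p. f (a *\<^sub>R fst p + b *\<^sub>R snd p, a *\<^sub>R snd p - b *\<^sub>R fst p)"] by simp
  also have "\<dots> = (\<integral>\<^sup>+p. (\<lambda>p. r p * f p) (a *\<^sub>R fst p + b *\<^sub>R snd p, a *\<^sub>R snd p - b *\<^sub>R fst p) \<partial>(lborel \<Otimes>\<^sub>M lborel))"
    by (simp add: r)
  also have "\<dots> = (\<integral>\<^sup>+p. r p * f p \<partial>(lborel \<Otimes>\<^sub>M lborel))"
    by (rule nn_integral_lborel_rotation) (use assms in auto)
  also have "\<dots> = (\<integral>\<^sup>+x. \<integral>\<^sup>+y. f (x, y) \<partial>std_gaussian \<partial>std_gaussian)"
    by (rule iter[symmetric]) auto
  finally show ?thesis .
qed

interpretation std_gaussian: prob_space "std_gaussian :: (real^'n) measure"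
  by (rule prob_space_std_gaussian)

interpretation std_gaussian_pair: pair_prob_space
  "std_gaussian :: (real^'n) measure" "std_gaussian :: (real^'n) measure" ..

text \<open>The first component of a rotated pair: a linear combination of two independent standard
  Gaussian vectors is a rescaled standard Gaussian vector.\<close>

lemma nn_integral_std_gaussian_sum:
  fixes f :: "real^'n \<Rightarrow> ennreal"
  assumes [measurable]: "f \<in> borel_measurable borel" and "0 \<le> \<alpha>"
  shows "(\<integral>\<^sup>+x. \<integral>\<^sup>+y. f (\<alpha> *\<^sub>R x + \<beta> *\<^sub>R y) \<partial>std_gaussian \<partial>std_gaussian)
    = (\<integral>\<^sup>+x. f (sqrt (\<alpha>\<^sup>2 + \<beta>\<^sup>2) *\<^sub>R x) \<partial>std_gaussian)"
proof (cases "\<alpha>\<^sup>2 + \<beta>\<^sup>2 = 0")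
  case True
  then have "\<alpha> = 0" "\<beta> = 0" by (simp_all add: sum_power2_eq_zero_iff)
  then show ?thesis by (simp add: std_gaussian.emeasure_space_1[simplified])
next
  case False
  define \<tau> where "\<tau> = sqrt (\<alpha>\<^sup>2 + \<beta>\<^sup>2)"
  have \<tau>: "\<tau> > 0" "\<tau>\<^sup>2 = \<alpha>\<^sup>2 + \<beta>\<^sup>2"
    using False by (auto simp: \<tau>_def less_le)
  have "(\<alpha> / \<tau>)\<^sup>2 + (\<beta> / \<tau>)\<^sup>2 = 1"
    using \<tau>(1) by (simp add: power_divide flip: add_divide_distrib \<tau>(2))
  moreover have "\<tau> *\<^sub>R ((\<alpha> / \<tau>) *\<^sub>R x + (\<beta> / \<tau>) *\<^sub>R y) = \<alpha> *\<^sub>R x + \<beta> *\<^sub>R y" for x y :: "real^'n"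
    using \<tau> by (simp add: scaleR_add_right)
  moreover have "(\<lambda>p::(real^'n) \<times> (real^'n). f (\<tau> *\<^sub>R fst p)) \<in> borel_measurable borel"
    unfolding borel_prod[symmetric] by measurable
  ultimately have "(\<integral>\<^sup>+x. \<integral>\<^sup>+y. f (\<alpha> *\<^sub>R x + \<beta> *\<^sub>R y) \<partial>std_gaussian \<partial>std_gaussian)
     = (\<integral>\<^sup>+x. \<integral>\<^sup>+(y::real^'n). f (\<tau> *\<^sub>R x) \<partial>std_gaussian \<partial>std_gaussian)"
    using nn_integral_std_gaussian_rotation[of "\<lambda>p. f (\<tau> *\<^sub>R fst p)" "\<alpha> / \<tau>" "\<beta> / \<tau>"] \<tau> assms(2)
    by simp
  then show ?thesis
    by (simp add: std_gaussian.emeasure_space_1[simplified] \<tau>_def)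
qed

section \<open>Correlated Gaussian pairs\<close>

text \<open>The joint law of two standard Gaussian vectors with cross-covariance \<open>s\<close> times the identity, for \<open>\<bar>s\<bar> \<le> 1\<close>.
  As a function of \<open>s\<close> it interpolates between independence and equality, and integrating against it
  amounts to applying the Ornstein-Uhlenbeck semigroup.\<close>

definition correlated_gaussian :: "real \<Rightarrow> ((real^'n) \<times> (real^'n)) measure" where
  "correlated_gaussian s = distr (std_gaussian \<Otimes>\<^sub>M std_gaussian) (borel \<Otimes>\<^sub>M borel)
     (\<lambda>p. (fst p, s *\<^sub>R fst p + sqrt (1 - s\<^sup>2) *\<^sub>R snd p))"

lemma sets_correlated_gaussian [simp, measurable_cong]:
  "sets (correlated_gaussian s) = sets (borel \<Otimes>\<^sub>M borel)"
  by (simp add: correlated_gaussian_def)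

lemma space_correlated_gaussian [simp]: "space (correlated_gaussian s) = UNIV"
  by (simp add: correlated_gaussian_def space_pair_measure)

lemma prob_space_correlated_gaussian:
  "prob_space (correlated_gaussian s :: ((real^'n) \<times> (real^'n)) measure)"
  unfolding correlated_gaussian_def
  by (rule std_gaussian_pair.prob_space_distr) measurable

lemma nn_integral_correlated_gaussian:
  fixes h :: "(real^'n) \<times> (real^'n) \<Rightarrow> ennreal"
  assumes [measurable]: "h \<in> borel_measurable (borel \<Otimes>\<^sub>M borel)"
  shows "(\<integral>\<^sup>+p. h p \<partial>correlated_gaussian s)
    = (\<integral>\<^sup>+x. \<integral>\<^sup>+y. h (x, s *\<^sub>R x + sqrt (1 - s\<^sup>2) *\<^sub>R y) \<partial>std_gaussian \<partial>std_gaussian)"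
proof -
  have "(\<integral>\<^sup>+p. h p \<partial>correlated_gaussian s)
     = (\<integral>\<^sup>+p. h (fst p, s *\<^sub>R fst p + sqrt (1 - s\<^sup>2) *\<^sub>R snd p) \<partial>(std_gaussian \<Otimes>\<^sub>M std_gaussian))"
    unfolding correlated_gaussian_def by (rule nn_integral_distr) auto
  also have "\<dots> = (\<integral>\<^sup>+x. \<integral>\<^sup>+y. h (x, s *\<^sub>R x + sqrt (1 - s\<^sup>2) *\<^sub>R y) \<partial>std_gaussian \<partial>std_gaussian)"
    by (subst std_gaussian.nn_integral_fst[symmetric]) auto
  finally show ?thesis .
qed

text \<open>Correlations mix linearly. If two independent pairs have correlations \<open>s\<close> and \<open>r\<close>, their
  combination with weights \<open>a\<close> and \<open>b\<close> is again a standard Gaussian pair, and its cross-covariance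
  is \<open>a\<^sup>2 s + b\<^sup>2 r\<close>. The cases \<open>r = 1\<close> (common noise), \<open>r = 0\<close> (independent noise), and
  \<open>s = 1, r = 0\<close> (the semigroup property) are what the sequel lives on.\<close>

lemma nn_integral_correlated_gaussian_mix:
  fixes h :: "(real^'n) \<times> (real^'n) \<Rightarrow> ennreal"
  assumes [measurable]: "h \<in> borel_measurable (borel \<Otimes>\<^sub>M borel)"
    and s: "\<bar>s\<bar> \<le> 1" and r: "\<bar>r\<bar> \<le> 1" and ab: "0 \<le> a" "0 \<le> b" "a\<^sup>2 + b\<^sup>2 = 1"
  shows "(\<integral>\<^sup>+p. \<integral>\<^sup>+q. h (a *\<^sub>R fst p + b *\<^sub>R fst q, a *\<^sub>R snd p + b *\<^sub>R snd q)
            \<partial>correlated_gaussian r \<partial>correlated_gaussian s)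
    = (\<integral>\<^sup>+p. h p \<partial>correlated_gaussian (a\<^sup>2 * s + b\<^sup>2 * r))"
proof -
  define \<sigma> \<rho> where "\<sigma> = sqrt (1 - s\<^sup>2)" and "\<rho> = sqrt (1 - r\<^sup>2)"
  define m where "m = a\<^sup>2 * s + b\<^sup>2 * r"
  define \<tau> where "\<tau> = sqrt ((a * \<sigma>)\<^sup>2 + (b * \<rho>)\<^sup>2)"
  have \<sigma>: "\<sigma> \<ge> 0" "\<sigma>\<^sup>2 = 1 - s\<^sup>2" and \<rho>: "\<rho> \<ge> 0" "\<rho>\<^sup>2 = 1 - r\<^sup>2"
    using s r by (auto simp: \<sigma>_def \<rho>_def abs_square_le_1)
  have \<tau>: "\<tau> \<ge> 0" "\<tau>\<^sup>2 = (a * \<sigma>)\<^sup>2 + (b * \<rho>)\<^sup>2"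
    by (auto simp: \<tau>_def)
  \<comment> \<open>Given the first vector of the combined pair, the second has two independent sources of randomness: the
    noises of the given pairs, of total size \<open>\<tau>\<close>, and the rotated complement of the first vector,
    of size \<open>a * b * (r - s)\<close>.\<close>
  have b2: "b\<^sup>2 = 1 - a\<^sup>2" using ab(3) by simp
  have "\<tau>\<^sup>2 + (a * b * (r - s))\<^sup>2 = a\<^sup>2 * (1 - s\<^sup>2) + b\<^sup>2 * (1 - r\<^sup>2) + a\<^sup>2 * b\<^sup>2 * (r - s)\<^sup>2"
    by (simp add: \<tau> power_mult_distrib \<sigma> \<rho>)
  also have "\<dots> = 1 - m\<^sup>2"
    unfolding b2 m_def by algebra
  finally have var: "\<tau>\<^sup>2 + (a * b * (r - s))\<^sup>2 = 1 - m\<^sup>2" .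
  let ?G = "std_gaussian :: (real^'n) measure"
  have "(\<integral>\<^sup>+p. \<integral>\<^sup>+q. h (a *\<^sub>R fst p + b *\<^sub>R fst q, a *\<^sub>R snd p + b *\<^sub>R snd q)
            \<partial>correlated_gaussian r \<partial>correlated_gaussian s)
     = (\<integral>\<^sup>+x. \<integral>\<^sup>+y. \<integral>\<^sup>+z. \<integral>\<^sup>+w. h (a *\<^sub>R x + b *\<^sub>R z, a *\<^sub>R (s *\<^sub>R x + \<sigma> *\<^sub>R y) + b *\<^sub>R (r *\<^sub>R z + \<rho> *\<^sub>R w))
          \<partial>?G \<partial>?G \<partial>?G \<partial>?G)"
  proof -
    interpret R: prob_space "correlated_gaussian r :: ((real^'n) \<times> (real^'n)) measure"
      by (rule prob_space_correlated_gaussian)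
    show ?thesis
      by (simp add: nn_integral_correlated_gaussian \<sigma>_def \<rho>_def)
  qed
  also have "\<dots> = (\<integral>\<^sup>+x. \<integral>\<^sup>+z. \<integral>\<^sup>+y. \<integral>\<^sup>+w. h (a *\<^sub>R x + b *\<^sub>R z, a *\<^sub>R (s *\<^sub>R x + \<sigma> *\<^sub>R y) + b *\<^sub>R (r *\<^sub>R z + \<rho> *\<^sub>R w))
          \<partial>?G \<partial>?G \<partial>?G \<partial>?G)"
    by (intro nn_integral_cong std_gaussian_pair.Fubini') measurable
  also have "\<dots> = (\<integral>\<^sup>+x. \<integral>\<^sup>+z. \<integral>\<^sup>+y. h (a *\<^sub>R x + b *\<^sub>R z, (a * s) *\<^sub>R x + (b * r) *\<^sub>R z + \<tau> *\<^sub>R y) \<partial>?G \<partial>?G \<partial>?G)"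
  proof (rule nn_integral_cong, rule nn_integral_cong)
    fix x z :: "real^'n"
    have "(\<integral>\<^sup>+y. \<integral>\<^sup>+w. h (a *\<^sub>R x + b *\<^sub>R z, a *\<^sub>R (s *\<^sub>R x + \<sigma> *\<^sub>R y) + b *\<^sub>R (r *\<^sub>R z + \<rho> *\<^sub>R w)) \<partial>?G \<partial>?G)
      = (\<integral>\<^sup>+y. \<integral>\<^sup>+w. h (a *\<^sub>R x + b *\<^sub>R z, ((a * s) *\<^sub>R x + (b * r) *\<^sub>R z) + ((a * \<sigma>) *\<^sub>R y + (b * \<rho>) *\<^sub>R w)) \<partial>?G \<partial>?G)"
      by (simp add: algebra_simps)
    also have "\<dots> = (\<integral>\<^sup>+y. h (a *\<^sub>R x + b *\<^sub>R z, ((a * s) *\<^sub>R x + (b * r) *\<^sub>R z) + \<tau> *\<^sub>R y) \<partial>?G)"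
      unfolding \<tau>_def
      by (rule nn_integral_std_gaussian_sum[where f = "\<lambda>u. h (a *\<^sub>R x + b *\<^sub>R z, ((a * s) *\<^sub>R x + (b * r) *\<^sub>R z) + u)"])
         (use ab \<sigma> in auto)
    finally show "(\<integral>\<^sup>+y. \<integral>\<^sup>+w. h (a *\<^sub>R x + b *\<^sub>R z, a *\<^sub>R (s *\<^sub>R x + \<sigma> *\<^sub>R y) + b *\<^sub>R (r *\<^sub>R z + \<rho> *\<^sub>R w)) \<partial>?G \<partial>?G)
      = (\<integral>\<^sup>+y. h (a *\<^sub>R x + b *\<^sub>R z, (a * s) *\<^sub>R x + (b * r) *\<^sub>R z + \<tau> *\<^sub>R y) \<partial>?G)" .
  qed
  also have "\<dots> = (\<integral>\<^sup>+x. \<integral>\<^sup>+y. \<integral>\<^sup>+z. h (a *\<^sub>R x + b *\<^sub>R z, (a * s) *\<^sub>R x + (b * r) *\<^sub>R z + \<tau> *\<^sub>R y) \<partial>?G \<partial>?G \<partial>?G)"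
    by (intro nn_integral_cong std_gaussian_pair.Fubini') measurable
  also have "\<dots> = (\<integral>\<^sup>+y. \<integral>\<^sup>+x. \<integral>\<^sup>+z. h (a *\<^sub>R x + b *\<^sub>R z, (a * s) *\<^sub>R x + (b * r) *\<^sub>R z + \<tau> *\<^sub>R y) \<partial>?G \<partial>?G \<partial>?G)"
    by (intro std_gaussian_pair.Fubini') measurable
  \<comment> \<open>Rotating \<open>(x, z)\<close> makes the first vector of the combined pair a coordinate \<open>p\<close>, independent of its
    complement \<open>q\<close>.\<close>
  also have "\<dots> = (\<integral>\<^sup>+y. \<integral>\<^sup>+p. \<integral>\<^sup>+q. h (p, m *\<^sub>R p + (\<tau> *\<^sub>R y + (a * b * (r - s)) *\<^sub>R q)) \<partial>?G \<partial>?G \<partial>?G)"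
  proof (rule nn_integral_cong)
    fix y :: "real^'n"
    define k where "k p = h (fst p, m *\<^sub>R fst p + (\<tau> *\<^sub>R y + (a * b * (r - s)) *\<^sub>R snd p))" for p :: "(real^'n) \<times> (real^'n)"
    have k: "k \<in> borel_measurable borel"
      unfolding k_def borel_prod[symmetric] by measurable
    have "h (a *\<^sub>R x + b *\<^sub>R z, (a * s) *\<^sub>R x + (b * r) *\<^sub>R z + \<tau> *\<^sub>R y) = k (a *\<^sub>R x + b *\<^sub>R z, a *\<^sub>R z - b *\<^sub>R x)" for x z
    proof -
      have "m *\<^sub>R (a *\<^sub>R x + b *\<^sub>R z) + (a * b * (r - s)) *\<^sub>R (a *\<^sub>R z - b *\<^sub>R x)
         = (m * a - a * b * (r - s) * b) *\<^sub>R x + (m * b + a * b * (r - s) * a) *\<^sub>R z"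
        by (simp add: algebra_simps)
      moreover have "m * a - a * b * (r - s) * b = a * s"
        using ab(3) unfolding m_def by algebra
      moreover have "m * b + a * b * (r - s) * a = b * r"
        using ab(3) unfolding m_def by algebra
      ultimately have "m *\<^sub>R (a *\<^sub>R x + b *\<^sub>R z) + (a * b * (r - s)) *\<^sub>R (a *\<^sub>R z - b *\<^sub>R x)
         = (a * s) *\<^sub>R x + (b * r) *\<^sub>R z"
        by simp
      then show ?thesis
        unfolding k_def by (simp add: add_ac)
    qed
    then have "(\<integral>\<^sup>+x. \<integral>\<^sup>+z. h (a *\<^sub>R x + b *\<^sub>R z, (a * s) *\<^sub>R x + (b * r) *\<^sub>R z + \<tau> *\<^sub>R y) \<partial>?G \<partial>?G)
      = (\<integral>\<^sup>+x. \<integral>\<^sup>+z. k (a *\<^sub>R x + b *\<^sub>R z, a *\<^sub>R z - b *\<^sub>R x) \<partial>?G \<partial>?G)" by simp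
    also have "\<dots> = (\<integral>\<^sup>+p. \<integral>\<^sup>+q. k (p, q) \<partial>?G \<partial>?G)"
      by (rule nn_integral_std_gaussian_rotation[OF k ab(1,3)])
    finally show "(\<integral>\<^sup>+x. \<integral>\<^sup>+z. h (a *\<^sub>R x + b *\<^sub>R z, (a * s) *\<^sub>R x + (b * r) *\<^sub>R z + \<tau> *\<^sub>R y) \<partial>?G \<partial>?G)
      = (\<integral>\<^sup>+p. \<integral>\<^sup>+q. h (p, m *\<^sub>R p + (\<tau> *\<^sub>R y + (a * b * (r - s)) *\<^sub>R q)) \<partial>?G \<partial>?G)"
      by (simp add: k_def)
  qed
  also have "\<dots> = (\<integral>\<^sup>+p. \<integral>\<^sup>+y. \<integral>\<^sup>+q. h (p, m *\<^sub>R p + (\<tau> *\<^sub>R y + (a * b * (r - s)) *\<^sub>R q)) \<partial>?G \<partial>?G \<partial>?G)"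
    by (intro std_gaussian_pair.Fubini') measurable
  also have "\<dots> = (\<integral>\<^sup>+p. \<integral>\<^sup>+y. h (p, m *\<^sub>R p + sqrt (1 - m\<^sup>2) *\<^sub>R y) \<partial>?G \<partial>?G)"
    unfolding var[symmetric]
    by (intro nn_integral_cong nn_integral_std_gaussian_sum[where f = "\<lambda>u. h (_, m *\<^sub>R _ + u)"] \<tau>) measurable
  also have "\<dots> = (\<integral>\<^sup>+p. h p \<partial>correlated_gaussian (a\<^sup>2 * s + b\<^sup>2 * r))"
    by (simp add: nn_integral_correlated_gaussian m_def)
  finally show ?thesis .
qed

lemma distr_correlated_gaussian_mix:
  assumes s: "\<bar>s\<bar> \<le> 1" and r: "\<bar>r\<bar> \<le> 1" and ab: "0 \<le> a" "0 \<le> b" "a\<^sup>2 + b\<^sup>2 = 1"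
  shows "distr (correlated_gaussian s \<Otimes>\<^sub>M correlated_gaussian r) (borel \<Otimes>\<^sub>M borel)
      (\<lambda>(p, q). (a *\<^sub>R fst p + b *\<^sub>R fst q, a *\<^sub>R snd p + b *\<^sub>R snd q))
    = (correlated_gaussian (a\<^sup>2 * s + b\<^sup>2 * r) :: ((real^'n) \<times> (real^'n)) measure)"
    (is "?L = ?R")
proof (rule measure_eqI)
  interpret R: prob_space "correlated_gaussian r :: ((real^'n) \<times> (real^'n)) measure"
    by (rule prob_space_correlated_gaussian)
  fix X assume "X \<in> sets ?L"
  then have [measurable]: "X \<in> sets (borel \<Otimes>\<^sub>M borel)" by simp
  have "emeasure ?L X = (\<integral>\<^sup>+p. indicator X p \<partial>?L)" by simp
  also have "\<dots> = (\<integral>\<^sup>+p. \<integral>\<^sup>+q. indicator X (a *\<^sub>R fst p + b *\<^sub>R fst q, a *\<^sub>R snd p + b *\<^sub>R snd q)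
            \<partial>correlated_gaussian r \<partial>correlated_gaussian s)"
    by (subst nn_integral_distr) (auto simp: split_beta' R.nn_integral_fst[symmetric])
  also have "\<dots> = (\<integral>\<^sup>+p. indicator X p \<partial>?R)"
    by (rule nn_integral_correlated_gaussian_mix) (use assms in auto)
  finally show "emeasure ?L X = emeasure ?R X" by simp
qed simp

lemma distr_correlated_gaussian_fst:
  "distr (correlated_gaussian s) borel fst = (std_gaussian :: (real^'n) measure)"
proof (rule measure_eqI)
  fix X assume "X \<in> sets (distr (correlated_gaussian s) borel fst :: (real^'n) measure)"
  then have [measurable]: "X \<in> sets borel" by simp
  have "emeasure (distr (correlated_gaussian s) borel fst) X
      = (\<integral>\<^sup>+x. indicator X x \<partial>distr (correlated_gaussian s) borel fst)" by simp
  also have "\<dots> = (\<integral>\<^sup>+x. \<integral>\<^sup>+(y::real^'n). indicator X x \<partial>std_gaussian \<partial>std_gaussian)"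
    by (subst nn_integral_distr) (auto simp: nn_integral_correlated_gaussian)
  finally show "emeasure (distr (correlated_gaussian s) borel fst) X
      = emeasure (std_gaussian :: (real^'n) measure) X"
    by (simp add: std_gaussian.emeasure_space_1[simplified])
qed simp

lemma distr_correlated_gaussian_snd:
  assumes "0 \<le> s" "s \<le> 1"
  shows "distr (correlated_gaussian s) borel snd = (std_gaussian :: (real^'n) measure)"
proof (rule measure_eqI)
  fix X assume "X \<in> sets (distr (correlated_gaussian s) borel snd :: (real^'n) measure)"
  then have [measurable]: "X \<in> sets borel" by simp
  have "s\<^sup>2 \<le> 1" using assms by (simp add: power_le_one)
  have "emeasure (distr (correlated_gaussian s) borel snd) X
      = (\<integral>\<^sup>+x. indicator X x \<partial>distr (correlated_gaussian s) borel snd)" by simp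
  also have "\<dots> = (\<integral>\<^sup>+x. \<integral>\<^sup>+(y::real^'n). indicator X (s *\<^sub>R x + sqrt (1 - s\<^sup>2) *\<^sub>R y) \<partial>std_gaussian \<partial>std_gaussian)"
    by (subst nn_integral_distr) (auto simp: nn_integral_correlated_gaussian)
  also have "\<dots> = emeasure (std_gaussian :: (real^'n) measure) X"
    using assms(1) \<open>s\<^sup>2 \<le> 1\<close> by (subst nn_integral_std_gaussian_sum) auto
  finally show "emeasure (distr (correlated_gaussian s) borel snd) X
      = emeasure (std_gaussian :: (real^'n) measure) X" .
qed simp

lemma correlated_gaussian_0:
  "correlated_gaussian 0 = (std_gaussian \<Otimes>\<^sub>M std_gaussian :: ((real^'n) \<times> (real^'n)) measure)"
  unfolding correlated_gaussian_def
  by (simp add: distr_id2 sets_pair_measure_cong[OF sets_std_gaussian sets_std_gaussian])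

lemma correlated_gaussian_1:
  "correlated_gaussian 1 = distr (std_gaussian :: (real^'n) measure) (borel \<Otimes>\<^sub>M borel) (\<lambda>x. (x, x))"
proof -
  have "correlated_gaussian 1 = distr (correlated_gaussian 1) (borel \<Otimes>\<^sub>M borel) (\<lambda>p. (fst p, fst p))"
    unfolding correlated_gaussian_def by (subst distr_distr) (auto simp: comp_def)
  also have "\<dots> = distr (distr (correlated_gaussian 1) borel fst) (borel \<Otimes>\<^sub>M borel) (\<lambda>x. (x, x))"
    by (subst distr_distr) (auto simp: comp_def)
  finally show ?thesis
    by (simp add: distr_correlated_gaussian_fst)
qed

lemma integral_correlated_gaussian:
  fixes h :: "(real^'n) \<times> (real^'n) \<Rightarrow> 'b::{banach, second_countable_topology}"
  assumes "integrable (correlated_gaussian s) h"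
  shows "(\<integral>p. h p \<partial>correlated_gaussian s)
    = (\<integral>x. \<integral>y. h (x, s *\<^sub>R x + sqrt (1 - s\<^sup>2) *\<^sub>R y) \<partial>std_gaussian \<partial>std_gaussian)"
    and "integrable std_gaussian (\<lambda>x. \<integral>y. h (x, s *\<^sub>R x + sqrt (1 - s\<^sup>2) *\<^sub>R y) \<partial>std_gaussian)"
    and "integrable (std_gaussian \<Otimes>\<^sub>M std_gaussian) (\<lambda>p. h (fst p, s *\<^sub>R fst p + sqrt (1 - s\<^sup>2) *\<^sub>R snd p))"
    and "(\<integral>p. h p \<partial>correlated_gaussian s) = (\<integral>p. h (fst p, s *\<^sub>R fst p + sqrt (1 - s\<^sup>2) *\<^sub>R snd p) \<partial>(std_gaussian \<Otimes>\<^sub>M std_gaussian))"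
proof -
  have [measurable]: "h \<in> borel_measurable (borel \<Otimes>\<^sub>M borel)"
    using borel_measurable_integrable[OF assms] by simp
  show i: "integrable (std_gaussian \<Otimes>\<^sub>M std_gaussian) (\<lambda>p. h (fst p, s *\<^sub>R fst p + sqrt (1 - s\<^sup>2) *\<^sub>R snd p))"
    using assms unfolding correlated_gaussian_def by (subst (asm) integrable_distr_eq) auto
  show e: "(\<integral>p. h p \<partial>correlated_gaussian s) = (\<integral>p. h (fst p, s *\<^sub>R fst p + sqrt (1 - s\<^sup>2) *\<^sub>R snd p) \<partial>(std_gaussian \<Otimes>\<^sub>M std_gaussian))"
    unfolding correlated_gaussian_def by (subst integral_distr) auto
  show "integrable std_gaussian (\<lambda>x. \<integral>y. h (x, s *\<^sub>R x + sqrt (1 - s\<^sup>2) *\<^sub>R y) \<partial>std_gaussian)"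
    using std_gaussian_pair.integrable_fst'[OF i] by simp
  show "(\<integral>p. h p \<partial>correlated_gaussian s)
    = (\<integral>x. \<integral>y. h (x, s *\<^sub>R x + sqrt (1 - s\<^sup>2) *\<^sub>R y) \<partial>std_gaussian \<partial>std_gaussian)"
    unfolding e using std_gaussian_pair.integral_fst'[OF i] by simp
qed

lemma integral_correlated_gaussian_mix:
  fixes h :: "(real^'n) \<times> (real^'n) \<Rightarrow> 'b::{banach, second_countable_topology}"
  assumes h: "integrable (correlated_gaussian (a\<^sup>2 * s + b\<^sup>2 * r)) h"
    and s: "\<bar>s\<bar> \<le> 1" and r: "\<bar>r\<bar> \<le> 1" and ab: "0 \<le> a" "0 \<le> b" "a\<^sup>2 + b\<^sup>2 = 1"
  shows "(\<integral>p. h p \<partial>correlated_gaussian (a\<^sup>2 * s + b\<^sup>2 * r))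
    = (\<integral>p. \<integral>q. h (a *\<^sub>R fst p + b *\<^sub>R fst q, a *\<^sub>R snd p + b *\<^sub>R snd q)
            \<partial>correlated_gaussian r \<partial>correlated_gaussian s)"
    and "integrable (correlated_gaussian s) (\<lambda>p. \<integral>q. h (a *\<^sub>R fst p + b *\<^sub>R fst q, a *\<^sub>R snd p + b *\<^sub>R snd q)
            \<partial>correlated_gaussian r)"
proof -
  interpret S: prob_space "correlated_gaussian s :: ((real^'n) \<times> (real^'n)) measure"
    by (rule prob_space_correlated_gaussian)
  interpret R: prob_space "correlated_gaussian r :: ((real^'n) \<times> (real^'n)) measure"
    by (rule prob_space_correlated_gaussian)
  interpret SR: pair_prob_space "correlated_gaussian s :: ((real^'n) \<times> (real^'n)) measure"
    "correlated_gaussian r :: ((real^'n) \<times> (real^'n)) measure" ..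
  have [measurable]: "h \<in> borel_measurable (borel \<Otimes>\<^sub>M borel)"
    using borel_measurable_integrable[OF h] by simp
  let ?m = "\<lambda>(p, q). (a *\<^sub>R fst p + b *\<^sub>R fst q, a *\<^sub>R snd p + b *\<^sub>R snd q) :: (real^'n) \<times> (real^'n)"
  note mix = distr_correlated_gaussian_mix[where 'n='n, OF s r ab, symmetric]
  have i: "integrable (correlated_gaussian s \<Otimes>\<^sub>M correlated_gaussian r) (\<lambda>pq. h (?m pq))"
    using h unfolding mix by (subst (asm) integrable_distr_eq) auto
  have e: "(\<integral>p. h p \<partial>correlated_gaussian (a\<^sup>2 * s + b\<^sup>2 * r)) = (\<integral>pq. h (?m pq) \<partial>(correlated_gaussian s \<Otimes>\<^sub>M correlated_gaussian r))"
    unfolding mix by (subst integral_distr) auto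
  show "(\<integral>p. h p \<partial>correlated_gaussian (a\<^sup>2 * s + b\<^sup>2 * r))
    = (\<integral>p. \<integral>q. h (a *\<^sub>R fst p + b *\<^sub>R fst q, a *\<^sub>R snd p + b *\<^sub>R snd q)
            \<partial>correlated_gaussian r \<partial>correlated_gaussian s)"
    unfolding e using SR.integral_fst'[OF i] by simp
  show "integrable (correlated_gaussian s) (\<lambda>p. \<integral>q. h (a *\<^sub>R fst p + b *\<^sub>R fst q, a *\<^sub>R snd p + b *\<^sub>R snd q)
            \<partial>correlated_gaussian r)"
    using SR.integrable_fst'[OF i] by simp
qed

lemma integral_correlated_gaussian_1:
  fixes h :: "(real^'n) \<times> (real^'n) \<Rightarrow> 'b::{banach, second_countable_topology}"
  assumes [measurable]: "h \<in> borel_measurable (borel \<Otimes>\<^sub>M borel)"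
  shows "(\<integral>p. h p \<partial>correlated_gaussian 1) = (\<integral>x. h (x, x) \<partial>std_gaussian)"
    and "integrable (correlated_gaussian 1) h \<longleftrightarrow> integrable std_gaussian (\<lambda>x. h (x, x))"
  unfolding correlated_gaussian_1 by (subst integral_distr integrable_distr_eq; simp)+

lemma integrable_correlated_gaussian_marginals:
  fixes f :: "real^'n \<Rightarrow> 'b::{banach, second_countable_topology}"
  assumes "0 \<le> s" "s \<le> 1" "integrable std_gaussian f"
  shows "integrable (correlated_gaussian s) (\<lambda>p. f (fst p))"
    and "integrable (correlated_gaussian s) (\<lambda>p. f (snd p))"
    and "(\<integral>p. f (fst p) \<partial>correlated_gaussian s) = (\<integral>x. f x \<partial>std_gaussian)"
    and "(\<integral>p. f (snd p) \<partial>correlated_gaussian s) = (\<integral>x. f x \<partial>std_gaussian)"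
proof -
  have [measurable]: "f \<in> borel_measurable borel"
    using borel_measurable_integrable[OF assms(3)] by simp
  show "integrable (correlated_gaussian s) (\<lambda>p. f (fst p))"
    using assms(3) unfolding distr_correlated_gaussian_fst[of s, symmetric]
    by (subst (asm) integrable_distr_eq) auto
  show "integrable (correlated_gaussian s) (\<lambda>p. f (snd p))"
    using assms(3) unfolding distr_correlated_gaussian_snd[OF assms(1,2), symmetric]
    by (subst (asm) integrable_distr_eq) auto
  show "(\<integral>p. f (fst p) \<partial>correlated_gaussian s) = (\<integral>x. f x \<partial>std_gaussian)"
    unfolding distr_correlated_gaussian_fst[of s, symmetric]
    by (subst integral_distr) auto
  show "(\<integral>p. f (snd p) \<partial>correlated_gaussian s) = (\<integral>x. f x \<partial>std_gaussian)"
    unfolding distr_correlated_gaussian_snd[OF assms(1,2), symmetric]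
    by (subst integral_distr) auto
qed

section \<open>Noise stability of Lipschitz functions\<close>

text \<open>The inner product of \<open>f\<close> with its image under the Ornstein-Uhlenbeck operator of correlation \<open>s\<close>.
  At \<open>s = 0\<close> it is the squared norm of the mean, at \<open>s = 1\<close> the second moment.\<close>

definition noise_stability :: "(real^'n \<Rightarrow> 'b::real_inner) \<Rightarrow> real \<Rightarrow> real" where
  "noise_stability f s = (\<integral>p. f (fst p) \<bullet> f (snd p) \<partial>correlated_gaussian s)"

lemma integrable_correlated_gaussian_inner:
  fixes f g :: "real^'n \<Rightarrow> 'b::euclidean_space"
  assumes s: "0 \<le> s" "s \<le> 1"
    and [measurable]: "f \<in> borel_measurable borel" "g \<in> borel_measurable borel"
    and "integrable std_gaussian (\<lambda>x. (norm (f x))\<^sup>2)" "integrable std_gaussian (\<lambda>x. (norm (g x))\<^sup>2)"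
  shows "integrable (correlated_gaussian s) (\<lambda>p. f (fst p) \<bullet> g (snd p))"
proof (rule Bochner_Integration.integrable_bound)
  show "integrable (correlated_gaussian s) (\<lambda>p. (norm (f (fst p)))\<^sup>2 + (norm (g (snd p)))\<^sup>2)"
    by (intro Bochner_Integration.integrable_add integrable_correlated_gaussian_marginals s assms)
  show "AE p in correlated_gaussian s.
      norm (f (fst p) \<bullet> g (snd p)) \<le> norm ((norm (f (fst p)))\<^sup>2 + (norm (g (snd p)))\<^sup>2)"
  proof (rule AE_I2)
    fix p :: "(real^'n) \<times> (real^'n)"
    have "\<bar>f (fst p) \<bullet> g (snd p)\<bar> \<le> norm (f (fst p)) * norm (g (snd p))"
      by (rule Cauchy_Schwarz_ineq2)
    also have "\<dots> \<le> (norm (f (fst p)))\<^sup>2 + (norm (g (snd p)))\<^sup>2"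
      using sum_squares_bound[of "norm (f (fst p))" "norm (g (snd p))"]
        mult_nonneg_nonneg[OF norm_ge_zero norm_ge_zero, of "f (fst p)" "g (snd p)"] by linarith
    finally show "norm (f (fst p) \<bullet> g (snd p)) \<le> norm ((norm (f (fst p)))\<^sup>2 + (norm (g (snd p)))\<^sup>2)"
      by simp
  qed
qed measurable

lemma noise_stability_0_1:
  fixes f :: "real^'n \<Rightarrow> 'b::euclidean_space"
  assumes [measurable]: "f \<in> borel_measurable borel" and f: "integrable std_gaussian f"
    and f2: "integrable std_gaussian (\<lambda>x. (norm (f x))\<^sup>2)"
  shows "noise_stability f 0 = (norm (\<integral>x. f x \<partial>std_gaussian))\<^sup>2"
    and "noise_stability f 1 = (\<integral>x. (norm (f x))\<^sup>2 \<partial>std_gaussian)"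
proof -
  have "noise_stability f 0 = (\<integral>x. \<integral>y. f x \<bullet> f y \<partial>std_gaussian \<partial>std_gaussian)"
    unfolding noise_stability_def
    by (subst integral_correlated_gaussian(1))
       (auto intro!: integrable_correlated_gaussian_inner f2)
  then show "noise_stability f 0 = (norm (\<integral>x. f x \<partial>std_gaussian))\<^sup>2"
    using f by (simp add: power2_norm_eq_inner)
  show "noise_stability f 1 = (\<integral>x. (norm (f x))\<^sup>2 \<partial>std_gaussian)"
    unfolding noise_stability_def
    by (subst integral_correlated_gaussian_1) (auto simp: power2_norm_eq_inner)
qed

lemma lipschitz_std_gaussian:
  fixes f :: "real^'n \<Rightarrow> 'b::euclidean_space"
  assumes L: "L-lipschitz_on UNIV f"
  shows "f \<in> borel_measurable borel"
    and "integrable std_gaussian f"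
    and "integrable std_gaussian (\<lambda>x. (norm (f x))\<^sup>2)"
proof -
  show [measurable]: "f \<in> borel_measurable borel"
    by (intro borel_measurable_continuous_onI lipschitz_on_continuous_on[OF L])
  have growth: "norm (f x) \<le> norm (f 0) + L * norm x" for x
  proof -
    have "norm (f x - f 0) \<le> L * norm x"
      using lipschitz_onD[OF L, of x 0] by (simp add: dist_norm)
    then show ?thesis using norm_triangle_sub[of "f x" "f 0"] by linarith
  qed
  have L0: "L \<ge> 0" by (rule lipschitz_on_nonneg[OF L])
  have pow: "integrable (std_gaussian :: (real^'n) measure) (\<lambda>x. norm x ^ k)" if "k \<le> 4" for k
    using that by (rule integrable_std_gaussian_norm_power)
  show "integrable std_gaussian f"
  proof (rule Bochner_Integration.integrable_bound)
    show "integrable (std_gaussian :: (real^'n) measure) (\<lambda>x. norm (f 0) + L * norm x)"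
      using pow[of 1] by simp
    show "AE x in std_gaussian. norm (f x) \<le> norm (norm (f 0) + L * norm x)"
      using growth by (intro AE_I2) (metis abs_ge_self order_trans real_norm_def)
  qed measurable
  show "integrable std_gaussian (\<lambda>x. (norm (f x))\<^sup>2)"
  proof (rule Bochner_Integration.integrable_bound)
    show "integrable (std_gaussian :: (real^'n) measure)
        (\<lambda>x. (norm (f 0))\<^sup>2 + (2 * norm (f 0) * L) * norm x + L\<^sup>2 * norm x ^ 2)"
      using pow[of 1] pow[of 2] by simp
    show "AE x in std_gaussian. norm ((norm (f x))\<^sup>2)
        \<le> norm ((norm (f 0))\<^sup>2 + (2 * norm (f 0) * L) * norm x + L\<^sup>2 * norm x ^ 2)"
    proof (rule AE_I2)
      fix x
      have "(norm (f x))\<^sup>2 \<le> (norm (f 0) + L * norm x)\<^sup>2"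
        using growth by (intro power_mono) auto
      then show "norm ((norm (f x))\<^sup>2) \<le> norm ((norm (f 0))\<^sup>2 + (2 * norm (f 0) * L) * norm x + L\<^sup>2 * norm x ^ 2)"
        by (simp add: power2_eq_square algebra_simps)
    qed
  qed measurable
qed

text \<open>The two faces of noise stability. With the Ornstein-Uhlenbeck operator \<open>T\<close> of correlation \<open>s\<close>,
  it is the inner product of \<open>f\<close> with \<open>T f\<close> at \<open>s\<close>, and the squared norm of \<open>T f\<close> at \<open>s\<^sup>2\<close>, since
  \<open>T\<close> is self-adjoint with square the operator of correlation \<open>s\<^sup>2\<close>. Both come from conditioning on a common
  component. The Lipschitz bound makes every inner integral converge, not only almost every one.\<close>

lemma noise_stability_semigroup:
  fixes f :: "real^'n \<Rightarrow> 'b::euclidean_space"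
  assumes L: "L-lipschitz_on UNIV f" and s: "0 \<le> s" "s \<le> 1"
  defines "T x \<equiv> \<integral>y. f (s *\<^sub>R x + sqrt (1 - s\<^sup>2) *\<^sub>R y) \<partial>std_gaussian"
  shows "noise_stability f s = (\<integral>x. f x \<bullet> T x \<partial>std_gaussian)"
    and "integrable std_gaussian (\<lambda>x. f x \<bullet> T x)"
    and "noise_stability f (s\<^sup>2) = (\<integral>x. (norm (T x))\<^sup>2 \<partial>std_gaussian)"
    and "integrable std_gaussian (\<lambda>x. (norm (T x))\<^sup>2)"
proof -
  note [measurable] = lipschitz_std_gaussian(1)[OF L]
  define \<sigma> where "\<sigma> = sqrt (1 - s\<^sup>2)"
  have s2: "0 \<le> s\<^sup>2" "s\<^sup>2 \<le> 1" using s by (auto simp: power_le_one)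
  have \<sigma>: "\<sigma> \<ge> 0" "s\<^sup>2 + \<sigma>\<^sup>2 = 1" using s2 by (auto simp: \<sigma>_def)
  have lip: "(L * \<sigma>)-lipschitz_on UNIV (\<lambda>y. f (s *\<^sub>R x + \<sigma> *\<^sub>R y))" for x
  proof (rule lipschitz_onI)
    fix y z
    have "dist (f (s *\<^sub>R x + \<sigma> *\<^sub>R y)) (f (s *\<^sub>R x + \<sigma> *\<^sub>R z)) \<le> L * dist (s *\<^sub>R x + \<sigma> *\<^sub>R y) (s *\<^sub>R x + \<sigma> *\<^sub>R z)"
      by (rule lipschitz_onD[OF L]) auto
    also have "dist (s *\<^sub>R x + \<sigma> *\<^sub>R y) (s *\<^sub>R x + \<sigma> *\<^sub>R z) = \<sigma> * dist y z"
      using \<sigma>(1) by (simp add: dist_norm flip: scaleR_diff_right)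
    finally show "dist (f (s *\<^sub>R x + \<sigma> *\<^sub>R y)) (f (s *\<^sub>R x + \<sigma> *\<^sub>R z)) \<le> L * \<sigma> * dist y z"
      by (simp add: mult.assoc)
  qed (use \<sigma>(1) lipschitz_on_nonneg[OF L] in auto)
  note fs = lipschitz_std_gaussian(2)[OF lip]
  have int: "integrable (correlated_gaussian t) (\<lambda>p. f (fst p) \<bullet> f (snd p))" if "0 \<le> t" "t \<le> 1" for t
    using that lipschitz_std_gaussian[OF L] by (intro integrable_correlated_gaussian_inner)
  have inner1: "(\<integral>y. f x \<bullet> f (s *\<^sub>R x + \<sigma> *\<^sub>R y) \<partial>std_gaussian) = f x \<bullet> T x" for x
    using fs by (simp add: T_def \<sigma>_def)
  show "noise_stability f s = (\<integral>x. f x \<bullet> T x \<partial>std_gaussian)"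
    and "integrable std_gaussian (\<lambda>x. f x \<bullet> T x)"
    using integral_correlated_gaussian(1,2)[OF int[OF s]] inner1
    by (simp_all add: noise_stability_def \<sigma>_def)
  have T_T: "(\<integral>q. f (s *\<^sub>R x + \<sigma> *\<^sub>R fst q) \<bullet> f (s *\<^sub>R x + \<sigma> *\<^sub>R snd q) \<partial>correlated_gaussian 0) = (norm (T x))\<^sup>2" for x
    using noise_stability_0_1(1)[OF lipschitz_std_gaussian[OF lip[of x]]]
    by (simp add: noise_stability_def T_def \<sigma>_def)
  have int': "integrable (correlated_gaussian (s\<^sup>2 * 1 + \<sigma>\<^sup>2 * 0)) (\<lambda>p. f (fst p) \<bullet> f (snd p))"
    using int[OF s2] by simp
  let ?q = "\<lambda>p. \<integral>q. f (s *\<^sub>R fst p + \<sigma> *\<^sub>R fst q) \<bullet> f (s *\<^sub>R snd p + \<sigma> *\<^sub>R snd q) \<partial>correlated_gaussian 0"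
  have q: "?q \<in> borel_measurable (borel \<Otimes>\<^sub>M borel)"
    using integral_correlated_gaussian_mix(2)[OF int'] s \<sigma> by auto
  note mix = integral_correlated_gaussian_mix[OF int' _ _ s(1) \<sigma>(1,2)]
  \<comment> \<open>A pair of correlation \<open>s\<^sup>2\<close> arises from a common vector by adding independent noises.\<close>
  have mix1: "noise_stability f (s\<^sup>2) = (\<integral>p. ?q p \<partial>correlated_gaussian 1)"
    and mix2: "integrable (correlated_gaussian 1) ?q"
    using mix by (simp_all add: noise_stability_def)
  show "noise_stability f (s\<^sup>2) = (\<integral>x. (norm (T x))\<^sup>2 \<partial>std_gaussian)"
    unfolding mix1 integral_correlated_gaussian_1(1)[OF q] by (simp add: T_T)
  show "integrable std_gaussian (\<lambda>x. (norm (T x))\<^sup>2)"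
    using mix2 unfolding integral_correlated_gaussian_1(2)[OF q] by (simp add: T_T)
qed

text \<open>For small \<open>s\<close> the second vector of a pair of correlation \<open>s\<close> is within \<open>O (s)\<close> of one independent
  of the first, and a Lipschitz function transports this bound.\<close>

lemma noise_stability_near_0:
  fixes f :: "real^'n \<Rightarrow> 'b::euclidean_space"
  assumes L: "L-lipschitz_on UNIV f"
  obtains c where "\<And>s. 0 \<le> s \<Longrightarrow> s \<le> 1 \<Longrightarrow> noise_stability f s \<le> noise_stability f 0 + c * s"
proof
  note [measurable] = lipschitz_std_gaussian(1)[OF L]
  define H where "H p = norm (f (fst p)) * (norm (fst p) + norm (snd p))" for p :: "(real^'n) \<times> (real^'n)"
  \<comment> \<open>The distance from \<open>s x + \<sigma> y\<close> to \<open>y\<close> is at most \<open>s (norm x + norm y)\<close> because \<open>1 - \<sigma> \<le> s\<close>.\<close>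
  define c where "c = L * (\<integral>p. H p \<partial>(std_gaussian \<Otimes>\<^sub>M std_gaussian))"
  have L0: "L \<ge> 0" by (rule lipschitz_on_nonneg[OF L])
  fix s :: real assume s: "0 \<le> s" "s \<le> 1"
  define \<sigma> where "\<sigma> = sqrt (1 - s\<^sup>2)"
  have "(1 - s)\<^sup>2 \<le> 1 - s\<^sup>2" using s by (simp add: power2_eq_square algebra_simps mult_left_le)
  then have \<sigma>: "1 - s \<le> \<sigma>" "\<sigma> \<le> 1"
    using s by (auto simp: \<sigma>_def intro: real_le_rsqrt)
  let ?GG = "std_gaussian \<Otimes>\<^sub>M std_gaussian :: ((real^'n) \<times> (real^'n)) measure"
  have n2: "integrable (std_gaussian :: (real^'n) measure) (\<lambda>x. (norm x)\<^sup>2)"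
    by (rule integrable_std_gaussian_norm_power) simp
  have H: "integrable ?GG H"
  proof (rule Bochner_Integration.integrable_bound)
    show "integrable ?GG (\<lambda>p. (norm (f (fst p)))\<^sup>2 + (norm (fst p))\<^sup>2 + (norm (snd p))\<^sup>2)"
      unfolding correlated_gaussian_0[symmetric]
      by (intro Bochner_Integration.integrable_add integrable_correlated_gaussian_marginals n2
          lipschitz_std_gaussian(3)[OF L]) auto
    show "AE p in ?GG. norm (H p) \<le> norm ((norm (f (fst p)))\<^sup>2 + (norm (fst p))\<^sup>2 + (norm (snd p))\<^sup>2)"
    proof (rule AE_I2)
      fix p :: "(real^'n) \<times> (real^'n)"
      have "H p \<le> (norm (f (fst p)))\<^sup>2 + (norm (fst p))\<^sup>2 + (norm (snd p))\<^sup>2"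
        unfolding H_def distrib_left
        using sum_squares_bound[of "norm (f (fst p))" "norm (fst p)"]
          sum_squares_bound[of "norm (f (fst p))" "norm (snd p)"]
          zero_le_power2[of "norm (fst p)"] zero_le_power2[of "norm (snd p)"]
        by linarith
      moreover have "H p \<ge> 0" by (simp add: H_def)
      ultimately show "norm (H p) \<le> norm ((norm (f (fst p)))\<^sup>2 + (norm (fst p))\<^sup>2 + (norm (snd p))\<^sup>2)"
        by simp
    qed
    show "H \<in> borel_measurable ?GG"
      unfolding H_def by measurable
  qed
  have int: "integrable (correlated_gaussian t) (\<lambda>p. f (fst p) \<bullet> f (snd p))" if "0 \<le> t" "t \<le> 1" for t
    using that lipschitz_std_gaussian[OF L] by (intro integrable_correlated_gaussian_inner)
  have "noise_stability f s - noise_stability f 0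
      = (\<integral>p. f (fst p) \<bullet> f (s *\<^sub>R fst p + \<sigma> *\<^sub>R snd p) \<partial>?GG) - (\<integral>p. f (fst p) \<bullet> f (snd p) \<partial>?GG)"
    using integral_correlated_gaussian(4)[OF int[OF s]]
    by (simp add: noise_stability_def correlated_gaussian_0 \<sigma>_def)
  also have "\<dots> = (\<integral>p. f (fst p) \<bullet> f (s *\<^sub>R fst p + \<sigma> *\<^sub>R snd p) - f (fst p) \<bullet> f (snd p) \<partial>?GG)"
    using integral_correlated_gaussian(3)[OF int[OF s]] int[of 0]
    by (subst Bochner_Integration.integral_diff) (auto simp: correlated_gaussian_0 \<sigma>_def)
  also have "\<dots> \<le> (\<integral>p. s * L * H p \<partial>?GG)"
  proof (rule integral_mono)
    show "integrable ?GG (\<lambda>p. f (fst p) \<bullet> f (s *\<^sub>R fst p + \<sigma> *\<^sub>R snd p) - f (fst p) \<bullet> f (snd p))"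
      using integral_correlated_gaussian(3)[OF int[OF s]] int[of 0]
      by (auto simp: correlated_gaussian_0 \<sigma>_def)
    show "integrable ?GG (\<lambda>p. s * L * H p)" using H by simp
    fix p :: "(real^'n) \<times> (real^'n)"
    obtain x y where p: "p = (x, y)" by fastforce
    have "norm ((s *\<^sub>R x + \<sigma> *\<^sub>R y) - y) = norm (s *\<^sub>R x - (1 - \<sigma>) *\<^sub>R y)"
      by (simp add: algebra_simps)
    also have "\<dots> \<le> s * norm x + (1 - \<sigma>) * norm y"
      using norm_triangle_ineq4[of "s *\<^sub>R x" "(1 - \<sigma>) *\<^sub>R y"] s \<sigma> by simp
    also have "\<dots> \<le> s * (norm x + norm y)"
      using \<sigma> mult_right_mono[of "1 - \<sigma>" s "norm y"] by (simp add: distrib_left)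
    finally have "L * norm ((s *\<^sub>R x + \<sigma> *\<^sub>R y) - y) \<le> L * (s * (norm x + norm y))"
      by (rule mult_left_mono) (rule L0)
    moreover have "norm (f (s *\<^sub>R x + \<sigma> *\<^sub>R y) - f y) \<le> L * norm ((s *\<^sub>R x + \<sigma> *\<^sub>R y) - y)"
      using lipschitz_onD[OF L, of "s *\<^sub>R x + \<sigma> *\<^sub>R y" y] by (simp add: dist_norm)
    ultimately have "norm (f x) * norm (f (s *\<^sub>R x + \<sigma> *\<^sub>R y) - f y) \<le> norm (f x) * (L * (s * (norm x + norm y)))"
      by (intro mult_left_mono) auto
    moreover have "f x \<bullet> f (s *\<^sub>R x + \<sigma> *\<^sub>R y) - f x \<bullet> f y \<le> norm (f x) * norm (f (s *\<^sub>R x + \<sigma> *\<^sub>R y) - f y)"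
      using norm_cauchy_schwarz[of "f x" "f (s *\<^sub>R x + \<sigma> *\<^sub>R y) - f y"] by (simp add: inner_diff_right)
    ultimately show "f (fst p) \<bullet> f (s *\<^sub>R fst p + \<sigma> *\<^sub>R snd p) - f (fst p) \<bullet> f (snd p) \<le> s * L * H p"
      by (simp add: p H_def mult_ac)
  qed
  also have "\<dots> = c * s" by (simp add: c_def)
  finally show "noise_stability f s \<le> noise_stability f 0 + c * s" by simp
qed

text \<open>Gebelein's inequality. Expanding the square of \<open>s f - T f\<close> gives
  \<open>2 (K s / s) \<le> K 1 + K (s\<^sup>2) / s\<^sup>2\<close>. The supremum \<open>R\<close> of \<open>K s / s\<close> over \<open>0 < s \<le> 1\<close> is finite because
  \<open>K s = O (s)\<close>, so it satisfies \<open>R \<le> (K 1 + R) / 2\<close>, that is, \<open>R \<le> K 1\<close>.\<close>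

lemma noise_stability_le_centered:
  fixes f :: "real^'n \<Rightarrow> 'b::euclidean_space"
  assumes L: "L-lipschitz_on UNIV f" and zero: "(\<integral>x. f x \<partial>std_gaussian) = 0"
    and s: "0 \<le> s" "s \<le> 1"
  shows "0 \<le> noise_stability f s" and "noise_stability f s \<le> s * noise_stability f 1"
proof -
  let ?K = "noise_stability f"
  have K0: "?K 0 = 0"
    by (simp add: noise_stability_0_1(1)[OF lipschitz_std_gaussian[OF L]] zero)
  have step: "2 * t * ?K t \<le> t\<^sup>2 * ?K 1 + ?K (t\<^sup>2)" if t: "0 \<le> t" "t \<le> 1" for t
  proof -
    define T where "T x = (\<integral>y. f (t *\<^sub>R x + sqrt (1 - t\<^sup>2) *\<^sub>R y) \<partial>std_gaussian)" for x
    note sg = noise_stability_semigroup[OF L t, folded T_def]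
    have "0 \<le> (\<integral>x. (norm (t *\<^sub>R f x - T x))\<^sup>2 \<partial>std_gaussian)"
      by (rule integral_nonneg_AE) simp
    also have "\<dots> = (\<integral>x. t\<^sup>2 * (norm (f x))\<^sup>2 - 2 * t * (f x \<bullet> T x) + (norm (T x))\<^sup>2 \<partial>std_gaussian)"
    proof (rule Bochner_Integration.integral_cong[OF refl])
      fix x
      show "(norm (t *\<^sub>R f x - T x))\<^sup>2 = t\<^sup>2 * (norm (f x))\<^sup>2 - 2 * t * (f x \<bullet> T x) + (norm (T x))\<^sup>2"
        unfolding power2_norm_eq_inner
        by (simp add: inner_simps inner_commute power2_eq_square algebra_simps)
    qed
    also have "\<dots> = t\<^sup>2 * ?K 1 - 2 * t * ?K t + ?K (t\<^sup>2)"
      using sg lipschitz_std_gaussian[OF L] by (simp add: noise_stability_0_1)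
    finally show ?thesis by simp
  qed
  have nonneg: "0 \<le> ?K t" if "0 \<le> t" "t \<le> 1" for t
  proof -
    have "?K ((sqrt t)\<^sup>2) \<ge> 0"
      using that by (subst noise_stability_semigroup(3)[OF L]) (auto intro!: integral_nonneg_AE)
    then show ?thesis using that by simp
  qed
  show "0 \<le> ?K s" by (rule nonneg[OF s])
  obtain c where c: "\<And>t. 0 \<le> t \<Longrightarrow> t \<le> 1 \<Longrightarrow> ?K t \<le> ?K 0 + c * t"
    using noise_stability_near_0[OF L] by blast
  define R where "R = (SUP t\<in>{0<..1}. ?K t / t)"
  have bdd: "bdd_above ((\<lambda>t. ?K t / t) ` {0<..1})"
  proof (rule bdd_aboveI2)
    fix t :: real assume "t \<in> {0<..1}"
    then show "?K t / t \<le> c" using c[of t] K0 by (simp add: field_simps)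
  qed
  have upper: "?K t / t \<le> R" if "0 < t" "t \<le> 1" for t
    unfolding R_def using that by (intro cSUP_upper bdd) auto
  have average: "2 * u \<le> w + x \<Longrightarrow> x \<le> y \<Longrightarrow> u \<le> (w + y) / 2" for u w x y :: real
    by simp
  have "R \<le> (?K 1 + R) / 2"
    unfolding R_def
  proof (rule cSUP_least)
    fix t :: real assume "t \<in> {0<..1}"
    then have t: "0 < t" "t \<le> 1" by auto
    then have "t\<^sup>2 \<le> 1" by (simp add: power_le_one)
    have "2 * (?K t / t) = 2 * t * ?K t / t\<^sup>2" using t by (simp add: power2_eq_square)
    also have "\<dots> \<le> (t\<^sup>2 * ?K 1 + ?K (t\<^sup>2)) / t\<^sup>2"
      using step[of t] t by (intro divide_right_mono) auto
    also have "\<dots> = ?K 1 + ?K (t\<^sup>2) / t\<^sup>2" using t by (simp add: add_divide_distrib)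
    finally have "2 * (?K t / t) \<le> ?K 1 + ?K (t\<^sup>2) / t\<^sup>2" .
    moreover have "?K (t\<^sup>2) / t\<^sup>2 \<le> R" using t \<open>t\<^sup>2 \<le> 1\<close> by (intro upper) auto
    ultimately show "?K t / t \<le> (?K 1 + (SUP t\<in>{0<..1}. ?K t / t)) / 2"
      unfolding R_def by (rule average)
  qed auto
  then have R: "R \<le> ?K 1" by simp
  show "?K s \<le> s * ?K 1"
  proof (cases "s = 0")
    case False
    with s have "?K s / s \<le> ?K 1" using upper[of s] R by simp
    then show ?thesis using False s by (simp add: field_simps)
  qed (simp add: K0)
qed

text \<open>Centring \<open>f\<close> lowers the noise stability at every correlation by the squared norm of the mean, which
  is its value at \<open>0\<close>.\<close>

lemma noise_stability_bounds:
  fixes f :: "real^'n \<Rightarrow> 'b::euclidean_space"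
  assumes L: "L-lipschitz_on UNIV f" and s: "0 \<le> s" "s \<le> 1"
  shows "noise_stability f 0 \<le> noise_stability f s"
    and "noise_stability f s \<le> (1 - s) * noise_stability f 0 + s * noise_stability f 1"
proof -
  define m where "m = (\<integral>x. f x \<partial>std_gaussian)"
  define g where "g x = f x - m" for x
  have Lg: "L-lipschitz_on UNIV g"
    using L unfolding lipschitz_on_def g_def by (simp add: dist_norm)
  have zero: "(\<integral>x. g x \<partial>std_gaussian) = 0"
    unfolding g_def using lipschitz_std_gaussian(2)[OF L] by (simp add: m_def std_gaussian.prob_space[simplified])
  have shift: "noise_stability g t = noise_stability f t - (norm m)\<^sup>2" if t: "0 \<le> t" "t \<le> 1" for t
  proof -
    interpret T: prob_space "correlated_gaussian t :: ((real^'n) \<times> (real^'n)) measure"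
      by (rule prob_space_correlated_gaussian)
    note marg = integrable_correlated_gaussian_marginals[OF t lipschitz_std_gaussian(2)[OF L]]
    have int: "integrable (correlated_gaussian t) (\<lambda>p. f (fst p) \<bullet> f (snd p))"
      using t lipschitz_std_gaussian[OF L] by (intro integrable_correlated_gaussian_inner)
    have "noise_stability g t
        = (\<integral>p. f (fst p) \<bullet> f (snd p) - m \<bullet> f (snd p) - f (fst p) \<bullet> m + m \<bullet> m \<partial>correlated_gaussian t)"
      unfolding noise_stability_def g_def by (simp add: inner_simps algebra_simps)
    also have "\<dots> = noise_stability f t - m \<bullet> m - m \<bullet> m + m \<bullet> m"
      using int marg by (simp add: noise_stability_def T.prob_space[simplified] flip: m_def)
    finally show ?thesis by (simp add: power2_norm_eq_inner)
  qed
  have "noise_stability f 0 = (norm m)\<^sup>2"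
    by (simp add: noise_stability_0_1(1)[OF lipschitz_std_gaussian[OF L]] m_def)
  then show "noise_stability f 0 \<le> noise_stability f s"
    and "noise_stability f s \<le> (1 - s) * noise_stability f 0 + s * noise_stability f 1"
    using noise_stability_le_centered[OF Lg zero s] s by (simp_all add: shift algebra_simps)
qed

section \<open>Noise stability of a function and of its gradient\<close>

lemma integrable_std_gaussian_poly:
  fixes c\<^sub>0 c\<^sub>1 c\<^sub>2 c\<^sub>3 c\<^sub>4 :: real
  assumes [measurable]: "f \<in> borel_measurable borel"
    and le: "\<And>x. \<bar>f x\<bar> \<le> c\<^sub>0 + c\<^sub>1 * norm x + c\<^sub>2 * norm x ^ 2 + c\<^sub>3 * norm x ^ 3 + c\<^sub>4 * norm x ^ 4"
  shows "integrable (std_gaussian :: (real^'n) measure) f"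
proof (rule Bochner_Integration.integrable_bound)
  have pow: "integrable (std_gaussian :: (real^'n) measure) (\<lambda>x. norm x ^ k)" if "k \<le> 4" for k
    using that by (rule integrable_std_gaussian_norm_power)
  show "integrable (std_gaussian :: (real^'n) measure)
      (\<lambda>x. c\<^sub>0 + c\<^sub>1 * norm x + c\<^sub>2 * norm x ^ 2 + c\<^sub>3 * norm x ^ 3 + c\<^sub>4 * norm x ^ 4)"
    using pow[of 1] pow[of 2] pow[of 3] pow[of 4] by simp
  show "AE x in (std_gaussian :: (real^'n) measure). norm (f x)
      \<le> norm (c\<^sub>0 + c\<^sub>1 * norm x + c\<^sub>2 * norm x ^ 2 + c\<^sub>3 * norm x ^ 3 + c\<^sub>4 * norm x ^ 4)"
    using le by (intro AE_I2) (metis abs_ge_self order_trans real_norm_def)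
qed measurable

lemma integrable_quadratic_remainder:
  fixes u :: "real^'n"
  assumes [measurable]: "\<phi> \<in> borel_measurable borel"
    and rem: "\<And>z. \<bar>\<phi> z - c - u \<bullet> z\<bar> \<le> \<kappa> * (norm z)\<^sup>2"
  shows "integrable std_gaussian \<phi>" and "integrable std_gaussian (\<lambda>z. (\<phi> z)\<^sup>2)"
proof -
  have le: "\<bar>\<phi> z\<bar> \<le> \<bar>c\<bar> + norm u * norm z + \<kappa> * (norm z)\<^sup>2" for z
    using rem[of z] Cauchy_Schwarz_ineq2[of u z] by linarith
  show "integrable std_gaussian \<phi>"
    by (rule integrable_std_gaussian_poly[where c\<^sub>0 = "\<bar>c\<bar>" and c\<^sub>1 = "norm u" and c\<^sub>2 = \<kappa> and c\<^sub>3 = 0 and c\<^sub>4 = 0])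
       (use le in auto)
  show "integrable std_gaussian (\<lambda>z. (\<phi> z)\<^sup>2)"
  proof (rule integrable_std_gaussian_poly)
    fix z
    have "\<bar>(\<phi> z)\<^sup>2\<bar> \<le> (\<bar>c\<bar> + norm u * norm z + \<kappa> * (norm z)\<^sup>2)\<^sup>2"
      using le[of z] by (auto intro: power2_le_iff_abs_le[THEN iffD2] order_trans simp: abs_le_square_iff[symmetric])
    also have "\<dots> = \<bar>c\<bar>\<^sup>2 + 2 * \<bar>c\<bar> * norm u * norm z + ((norm u)\<^sup>2 + 2 * \<bar>c\<bar> * \<kappa>) * norm z ^ 2
        + 2 * norm u * \<kappa> * norm z ^ 3 + \<kappa>\<^sup>2 * norm z ^ 4"
      by algebra
    finally show "\<bar>(\<phi> z)\<^sup>2\<bar> \<le> \<bar>c\<bar>\<^sup>2 + 2 * \<bar>c\<bar> * norm u * norm z + ((norm u)\<^sup>2 + 2 * \<bar>c\<bar> * \<kappa>) * norm z ^ 2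
        + 2 * norm u * \<kappa> * norm z ^ 3 + \<kappa>\<^sup>2 * norm z ^ 4" .
  qed measurable
qed

text \<open>Under the Gaussian law, the covariance of two linear forms is the inner product of their
  vectors. Functions that are affine up to a quadratic remainder have this covariance too, up
  to mixed terms: a linear form against a remainder costs a third moment, two remainders a
  fourth.\<close>

lemma covariance_quadratic_remainder:
  fixes u w :: "real^'n"
  assumes [measurable]: "\<phi> \<in> borel_measurable borel" "\<psi> \<in> borel_measurable borel"
    and \<phi>: "\<And>z. \<bar>\<phi> z - c - u \<bullet> z\<bar> \<le> \<kappa> * (norm z)\<^sup>2"
    and \<psi>: "\<And>z. \<bar>\<psi> z - c' - w \<bullet> z\<bar> \<le> \<kappa> * (norm z)\<^sup>2"
  defines "m k \<equiv> \<integral>z. norm z ^ k \<partial>(std_gaussian :: (real^'n) measure)"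
  shows "\<bar>(\<integral>z. \<phi> z * \<psi> z \<partial>std_gaussian) - (\<integral>z. \<phi> z \<partial>std_gaussian) * (\<integral>z. \<psi> z \<partial>std_gaussian) - u \<bullet> w\<bar>
    \<le> \<kappa> * m 3 * (norm u + norm w) + \<kappa>\<^sup>2 * (m 4 + (m 2)\<^sup>2)"
proof -
  let ?G = "std_gaussian :: (real^'n) measure"
  define P Q where "P z = \<phi> z - c - u \<bullet> z" and "Q z = \<psi> z - c' - w \<bullet> z" for z
  have [measurable]: "P \<in> borel_measurable borel" "Q \<in> borel_measurable borel"
    unfolding P_def Q_def by measurable
  have P: "\<bar>P z\<bar> \<le> \<kappa> * (norm z)\<^sup>2" and Q: "\<bar>Q z\<bar> \<le> \<kappa> * (norm z)\<^sup>2" for z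
    using \<phi> \<psi> by (auto simp: P_def Q_def)
  have \<kappa>: "\<kappa> \<ge> 0"
    using order_trans[OF abs_ge_zero P, of "axis undefined 1"] by (simp add: norm_axis_1)
  have pow: "integrable ?G (\<lambda>x. norm x ^ k)" if "k \<le> 4" for k
    using that by (rule integrable_std_gaussian_norm_power)
  have iP: "integrable ?G P" and iQ: "integrable ?G Q"
    by (rule integrable_quadratic_remainder(1)[where c = 0 and u = 0 and \<kappa> = \<kappa>]; use P Q in simp)+
  have uQ: "\<bar>(u \<bullet> z) * Q z\<bar> \<le> norm u * \<kappa> * norm z ^ 3"
    and wP: "\<bar>(w \<bullet> z) * P z\<bar> \<le> norm w * \<kappa> * norm z ^ 3"
    and PQ: "\<bar>P z * Q z\<bar> \<le> \<kappa>\<^sup>2 * norm z ^ 4" for z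
    using mult_mono[OF Cauchy_Schwarz_ineq2[of u z] Q[of z]] mult_mono[OF Cauchy_Schwarz_ineq2[of w z] P[of z]]
      mult_mono[OF P[of z] Q[of z]] \<kappa>
    by (simp_all add: abs_mult power2_eq_square power3_eq_cube power4_eq_xxxx mult_ac)
  have iuQ: "integrable ?G (\<lambda>z. (u \<bullet> z) * Q z)"
    by (rule integrable_std_gaussian_poly[where c\<^sub>0 = 0 and c\<^sub>1 = 0 and c\<^sub>2 = 0 and c\<^sub>3 = "norm u * \<kappa>" and c\<^sub>4 = 0])
       (use uQ in auto)
  have iwP: "integrable ?G (\<lambda>z. (w \<bullet> z) * P z)"
    by (rule integrable_std_gaussian_poly[where c\<^sub>0 = 0 and c\<^sub>1 = 0 and c\<^sub>2 = 0 and c\<^sub>3 = "norm w * \<kappa>" and c\<^sub>4 = 0])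
       (use wP in auto)
  have iPQ: "integrable ?G (\<lambda>z. P z * Q z)"
    by (rule integrable_std_gaussian_poly[where c\<^sub>0 = 0 and c\<^sub>1 = 0 and c\<^sub>2 = 0 and c\<^sub>3 = 0 and c\<^sub>4 = "\<kappa>\<^sup>2"])
       (use PQ in auto)
  have iu: "integrable ?G (\<lambda>z. v \<bullet> z)" for v
    by (rule integrable_quadratic_remainder(1)[where c = 0 and u = v and \<kappa> = 0]) auto
  have iuw: "integrable ?G (\<lambda>z. (u \<bullet> z) * (w \<bullet> z))"
  proof (rule integrable_std_gaussian_poly[where c\<^sub>0 = 0 and c\<^sub>1 = 0 and c\<^sub>2 = "norm u * norm w" and c\<^sub>3 = 0 and c\<^sub>4 = 0])
    fix z
    show "\<bar>u \<bullet> z * (w \<bullet> z)\<bar> \<le> 0 + 0 * norm z + norm u * norm w * (norm z)\<^sup>2 + 0 * norm z ^ 3 + 0 * norm z ^ 4"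
      using mult_mono[OF Cauchy_Schwarz_ineq2[of u z] Cauchy_Schwarz_ineq2[of w z]]
      by (simp add: abs_mult power2_eq_square mult_ac)
  qed measurable
  have \<phi>_eq: "\<phi> z = c + u \<bullet> z + P z" and \<psi>_eq: "\<psi> z = c' + w \<bullet> z + Q z" for z
    by (auto simp: P_def Q_def)
  have E\<phi>: "(\<integral>z. \<phi> z \<partial>?G) = c + (\<integral>z. P z \<partial>?G)" and E\<psi>: "(\<integral>z. \<psi> z \<partial>?G) = c' + (\<integral>z. Q z \<partial>?G)"
    unfolding \<phi>_eq \<psi>_eq using iP iQ iu
    by (simp_all add: integral_std_gaussian_inner std_gaussian.prob_space[simplified])
  have "(\<integral>z. \<phi> z * \<psi> z \<partial>?G) = (\<integral>z. c * c' + c * (w \<bullet> z) + c * Q z + c' * (u \<bullet> z) + (u \<bullet> z) * (w \<bullet> z) + (u \<bullet> z) * Q z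
      + c' * P z + (w \<bullet> z) * P z + P z * Q z \<partial>?G)"
    unfolding \<phi>_eq \<psi>_eq by (simp add: algebra_simps)
  also have "\<dots> = c * c' + c * (\<integral>z. Q z \<partial>?G) + u \<bullet> w + (\<integral>z. (u \<bullet> z) * Q z \<partial>?G)
      + c' * (\<integral>z. P z \<partial>?G) + (\<integral>z. (w \<bullet> z) * P z \<partial>?G) + (\<integral>z. P z * Q z \<partial>?G)"
    using iP iQ iu iuQ iwP iPQ iuw
    by (simp add: integral_std_gaussian_inner integral_std_gaussian_inner_mult std_gaussian.prob_space[simplified])
  finally have "(\<integral>z. \<phi> z * \<psi> z \<partial>?G) - (\<integral>z. \<phi> z \<partial>?G) * (\<integral>z. \<psi> z \<partial>?G) - u \<bullet> w
     = (\<integral>z. (u \<bullet> z) * Q z \<partial>?G) + (\<integral>z. (w \<bullet> z) * P z \<partial>?G) + (\<integral>z. P z * Q z \<partial>?G)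
      - (\<integral>z. P z \<partial>?G) * (\<integral>z. Q z \<partial>?G)"
    unfolding E\<phi> E\<psi> by (simp add: algebra_simps)
  moreover have "\<bar>\<integral>z. (u \<bullet> z) * Q z \<partial>?G\<bar> \<le> norm u * \<kappa> * m 3"
  proof -
    have "\<bar>\<integral>z. (u \<bullet> z) * Q z \<partial>?G\<bar> \<le> (\<integral>z. norm u * \<kappa> * norm z ^ 3 \<partial>?G)"
      using pow[of 3] by (intro integral_abs_bound[THEN order_trans] integral_mono integrable_abs iuQ uQ) simp
    then show ?thesis by (simp add: m_def)
  qed
  moreover have "\<bar>\<integral>z. (w \<bullet> z) * P z \<partial>?G\<bar> \<le> norm w * \<kappa> * m 3"
  proof -
    have "\<bar>\<integral>z. (w \<bullet> z) * P z \<partial>?G\<bar> \<le> (\<integral>z. norm w * \<kappa> * norm z ^ 3 \<partial>?G)"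
      using pow[of 3] by (intro integral_abs_bound[THEN order_trans] integral_mono integrable_abs iwP wP) simp
    then show ?thesis by (simp add: m_def)
  qed
  moreover have "\<bar>\<integral>z. P z * Q z \<partial>?G\<bar> \<le> \<kappa>\<^sup>2 * m 4"
  proof -
    have "\<bar>\<integral>z. P z * Q z \<partial>?G\<bar> \<le> (\<integral>z. \<kappa>\<^sup>2 * norm z ^ 4 \<partial>?G)"
      using pow[of 4] by (intro integral_abs_bound[THEN order_trans] integral_mono integrable_abs iPQ PQ) simp
    then show ?thesis by (simp add: m_def)
  qed
  moreover have "\<bar>(\<integral>z. P z \<partial>?G) * (\<integral>z. Q z \<partial>?G)\<bar> \<le> \<kappa>\<^sup>2 * (m 2)\<^sup>2"
  proof -
    have "\<bar>\<integral>z. P z \<partial>?G\<bar> \<le> (\<integral>z. \<kappa> * (norm z)\<^sup>2 \<partial>?G)" "\<bar>\<integral>z. Q z \<partial>?G\<bar> \<le> (\<integral>z. \<kappa> * (norm z)\<^sup>2 \<partial>?G)"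
      using pow[of 2] by (intro integral_abs_bound[THEN order_trans] integral_mono integrable_abs iP iQ P Q; simp)+
    then have "\<bar>\<integral>z. P z \<partial>?G\<bar> \<le> \<kappa> * m 2" "\<bar>\<integral>z. Q z \<partial>?G\<bar> \<le> \<kappa> * m 2"
      by (simp_all add: m_def)
    from mult_mono[OF this] \<kappa> show ?thesis
      by (simp add: abs_mult power2_eq_square mult_ac m_def)
  qed
  ultimately show ?thesis by (simp add: algebra_simps)
qed

text \<open>A finite-difference form of the covariance identity that equates the derivative of the noise
  stability of \<open>F\<close> with the noise stability of its gradient \<open>D\<close>. Given the pair \<open>(A, B)\<close>, the
  difference between common and independent added noise is the covariance of \<open>F (a A + b Z)\<close> and
  \<open>F (a B + b Z)\<close> in the single Gaussian vector \<open>Z\<close>.\<close>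

lemma noise_stability_step:
  fixes F :: "real^'n \<Rightarrow> real" and D :: "real^'n \<Rightarrow> real^'n"
  assumes [measurable]: "F \<in> borel_measurable borel" and L: "L-lipschitz_on UNIV D"
    and taylor: "\<And>x h. \<bar>F (x + h) - F x - D x \<bullet> h\<bar> \<le> \<kappa> * (norm h)\<^sup>2"
  obtains c where "\<And>s a b. 0 \<le> s \<Longrightarrow> s \<le> 1 \<Longrightarrow> 0 \<le> a \<Longrightarrow> 0 \<le> b \<Longrightarrow> a\<^sup>2 + b\<^sup>2 = 1 \<Longrightarrow>
    \<bar>noise_stability F (a\<^sup>2 * s + b\<^sup>2) - noise_stability F (a\<^sup>2 * s)
      - b\<^sup>2 * noise_stability (\<lambda>x. D (a *\<^sub>R x)) s\<bar> \<le> c * b ^ 3"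
proof
  let ?G = "std_gaussian :: (real^'n) measure"
  define m where "m k = (\<integral>z. norm z ^ k \<partial>?G)" for k
  define c where "c = \<kappa> * m 3 * (2 * (norm (D 0) + L * m 1)) + \<kappa>\<^sup>2 * (m 4 + (m 2)\<^sup>2)"
  fix s a b :: real
  assume s: "0 \<le> s" "s \<le> 1" and ab: "0 \<le> a" "0 \<le> b" "a\<^sup>2 + b\<^sup>2 = 1"
  have sq1: "a\<^sup>2 \<le> 1" "b\<^sup>2 \<le> 1"
    using ab(3) zero_le_power2[of a] zero_le_power2[of b] by linarith+
  then have ab1: "a \<le> 1" "b \<le> 1" "a\<^sup>2 \<le> 1"
    by (simp_all add: power2_le_imp_le)
  have \<kappa>: "\<kappa> \<ge> 0"
    using order_trans[OF abs_ge_zero taylor, of "axis undefined 1"] by (simp add: norm_axis_1)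
  have L0: "L \<ge> 0" by (rule lipschitz_on_nonneg[OF L])
  have m: "m k \<ge> 0" for k by (simp add: m_def)
  define \<phi> where "\<phi> x z = F (a *\<^sub>R x + b *\<^sub>R z)" for x z
  have [measurable]: "\<phi> x \<in> borel_measurable borel" for x
    unfolding \<phi>_def by measurable
  have \<phi>: "\<bar>\<phi> x z - F (a *\<^sub>R x) - (b *\<^sub>R D (a *\<^sub>R x)) \<bullet> z\<bar> \<le> (\<kappa> * b\<^sup>2) * (norm z)\<^sup>2" for x z
    using taylor[of "a *\<^sub>R x" "b *\<^sub>R z"] by (simp add: \<phi>_def power_mult_distrib mult_ac)
  note \<phi>_int = integrable_quadratic_remainder[OF _ \<phi>, simplified]
  have F_int: "integrable ?G (\<lambda>x. (F x)\<^sup>2)"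
    using taylor[of 0] by (intro integrable_quadratic_remainder(2)[where c = "F 0" and u = "D 0" and \<kappa> = \<kappa>]) auto
  have FF: "integrable (correlated_gaussian t) (\<lambda>p. F (fst p) \<bullet> F (snd p))" if "0 \<le> t" "t \<le> 1" for t
    using that F_int by (intro integrable_correlated_gaussian_inner) auto
  have range: "0 \<le> a\<^sup>2 * s + b\<^sup>2 * 1" "a\<^sup>2 * s + b\<^sup>2 * 1 \<le> 1" "0 \<le> a\<^sup>2 * s + b\<^sup>2 * 0" "a\<^sup>2 * s + b\<^sup>2 * 0 \<le> 1"
    using s ab mult_left_le[of s "a\<^sup>2"] ab1 by auto
  have one: "(\<integral>q. F (a *\<^sub>R fst p + b *\<^sub>R fst q) * F (a *\<^sub>R snd p + b *\<^sub>R snd q) \<partial>correlated_gaussian 1)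
      = (\<integral>z. \<phi> (fst p) z * \<phi> (snd p) z \<partial>?G)" for p
    by (subst integral_correlated_gaussian_1) (auto simp: \<phi>_def)
  have zero: "(\<integral>q. F (a *\<^sub>R fst p + b *\<^sub>R fst q) * F (a *\<^sub>R snd p + b *\<^sub>R snd q) \<partial>correlated_gaussian 0)
      = (\<integral>z. \<phi> (fst p) z \<partial>?G) * (\<integral>z. \<phi> (snd p) z \<partial>?G)" for p
  proof -
    have "integrable (correlated_gaussian 0) (\<lambda>q. \<phi> (fst p) (fst q) \<bullet> \<phi> (snd p) (snd q))"
      using \<phi>_int by (intro integrable_correlated_gaussian_inner) auto
    from integral_correlated_gaussian(1)[OF this] show ?thesis
      using \<phi>_int by (simp add: \<phi>_def)
  qed
  \<comment> \<open>The covariance of \<open>F (a A + b Z)\<close> and \<open>F (a B + b Z)\<close> given the pair \<open>p = (A, B)\<close>.\<close>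
  define cov where "cov p = (\<integral>z. \<phi> (fst p) z * \<phi> (snd p) z \<partial>?G)
      - (\<integral>z. \<phi> (fst p) z \<partial>?G) * (\<integral>z. \<phi> (snd p) z \<partial>?G)" for p
  note mix1 = integral_correlated_gaussian_mix[OF FF[OF range(1,2)] _ _ ab]
  note mix0 = integral_correlated_gaussian_mix[OF FF[OF range(3,4)] _ _ ab]
  have cov: "noise_stability F (a\<^sup>2 * s + b\<^sup>2) - noise_stability F (a\<^sup>2 * s) = (\<integral>p. cov p \<partial>correlated_gaussian s)"
    and icov: "integrable (correlated_gaussian s) cov"
    using mix1 mix0 s by (simp_all add: one zero noise_stability_def cov_def[abs_def])
  have La: "(L * a)-lipschitz_on UNIV (\<lambda>x. D (a *\<^sub>R x))"
  proof (rule lipschitz_onI)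
    fix y z
    have "dist (D (a *\<^sub>R y)) (D (a *\<^sub>R z)) \<le> L * dist (a *\<^sub>R y) (a *\<^sub>R z)"
      by (rule lipschitz_onD[OF L]) auto
    also have "dist (a *\<^sub>R y) (a *\<^sub>R z) = a * dist y z"
      using ab(1) by (simp add: dist_norm flip: scaleR_diff_right)
    finally show "dist (D (a *\<^sub>R y)) (D (a *\<^sub>R z)) \<le> L * a * dist y z"
      by (simp add: mult.assoc)
  qed (use ab L0 in simp)
  have DD: "integrable (correlated_gaussian s) (\<lambda>p. D (a *\<^sub>R fst p) \<bullet> D (a *\<^sub>R snd p))"
    using integrable_correlated_gaussian_inner[OF s _ _ _ _] lipschitz_std_gaussian[OF La] s by blast
  have Dle: "norm (D (a *\<^sub>R x)) \<le> norm (D 0) + L * norm x" for x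
  proof -
    have "norm (D (a *\<^sub>R x) - D 0) \<le> L * (a * norm x)"
      using lipschitz_onD[OF L, of "a *\<^sub>R x" 0] ab by (simp add: dist_norm)
    also have "\<dots> \<le> L * norm x"
      using ab1 L0 by (intro mult_left_mono mult_left_le_one_le ab) auto
    finally show ?thesis using norm_triangle_sub[of "D (a *\<^sub>R x)" "D 0"] by linarith
  qed
  define B where "B p = \<kappa> * m 3 * ((norm (D 0) + L * norm (fst p)) + (norm (D 0) + L * norm (snd p))) + \<kappa>\<^sup>2 * (m 4 + (m 2)\<^sup>2)" for p :: "(real^'n) \<times> (real^'n)"
  have le: "\<bar>cov p - b\<^sup>2 * (D (a *\<^sub>R fst p) \<bullet> D (a *\<^sub>R snd p))\<bar> \<le> b ^ 3 * B p" for p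
  proof -
    have "\<bar>cov p - (b *\<^sub>R D (a *\<^sub>R fst p)) \<bullet> (b *\<^sub>R D (a *\<^sub>R snd p))\<bar>
      \<le> (\<kappa> * b\<^sup>2) * m 3 * (norm (b *\<^sub>R D (a *\<^sub>R fst p)) + norm (b *\<^sub>R D (a *\<^sub>R snd p))) + (\<kappa> * b\<^sup>2)\<^sup>2 * (m 4 + (m 2)\<^sup>2)"
      unfolding cov_def m_def by (rule covariance_quadratic_remainder[OF _ _ \<phi> \<phi>]) measurable
    also have "\<dots> = b ^ 3 * (\<kappa> * m 3 * (norm (D (a *\<^sub>R fst p)) + norm (D (a *\<^sub>R snd p)))) + b ^ 4 * (\<kappa>\<^sup>2 * (m 4 + (m 2)\<^sup>2))"
      using ab by (simp add: algebra_simps power2_eq_square power3_eq_cube power4_eq_xxxx)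
    also have "\<dots> \<le> b ^ 3 * (\<kappa> * m 3 * ((norm (D 0) + L * norm (fst p)) + (norm (D 0) + L * norm (snd p)))) + b ^ 3 * (\<kappa>\<^sup>2 * (m 4 + (m 2)\<^sup>2))"
      using ab ab1 m \<kappa> Dle
      by (intro add_mono mult_left_mono mult_right_mono power_decreasing mult_nonneg_nonneg add_nonneg_nonneg) auto
    also have "\<dots> = b ^ 3 * B p" by (simp add: B_def algebra_simps)
    finally show ?thesis by (simp add: power2_eq_square mult.assoc)
  qed
  interpret S: prob_space "correlated_gaussian s :: ((real^'n) \<times> (real^'n)) measure"
    by (rule prob_space_correlated_gaussian)
  have n1: "integrable ?G norm"
    using integrable_std_gaussian_norm_power[of 1] by simp
  note marg = integrable_correlated_gaussian_marginals[OF s n1]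
  have iB: "integrable (correlated_gaussian s) B"
    unfolding B_def using marg by simp
  have "noise_stability F (a\<^sup>2 * s + b\<^sup>2) - noise_stability F (a\<^sup>2 * s) - b\<^sup>2 * noise_stability (\<lambda>x. D (a *\<^sub>R x)) s
      = (\<integral>p. cov p - b\<^sup>2 * (D (a *\<^sub>R fst p) \<bullet> D (a *\<^sub>R snd p)) \<partial>correlated_gaussian s)"
    using icov DD by (simp add: cov noise_stability_def[of "\<lambda>x. D (a *\<^sub>R x)"])
  also have "\<bar>\<dots>\<bar> \<le> (\<integral>p. b ^ 3 * B p \<partial>correlated_gaussian s)"
    using icov DD iB le by (intro integral_abs_bound[THEN order_trans] integral_mono) auto
  also have "\<dots> = b ^ 3 * c"
    using marg unfolding B_def by (simp add: c_def S.prob_space[simplified] m_def algebra_simps)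
  finally show "\<bar>noise_stability F (a\<^sup>2 * s + b\<^sup>2) - noise_stability F (a\<^sup>2 * s)
      - b\<^sup>2 * noise_stability (\<lambda>x. D (a *\<^sub>R x)) s\<bar> \<le> c * b ^ 3" by (simp add: mult.commute)
qed

text \<open>A function whose decrease over a step of length \<open>h\<close> is at most of order \<open>h powr (3/2)\<close> cannot
  decrease at all: over \<open>n\<close> equal steps the total loss is of order \<open>n powr (- 1/2)\<close>. Steps are written
  as \<open>b\<^sup>2\<close> because this is how much correlation a noise of size \<open>b\<close> adds.\<close>

lemma superlinear_loss_mono:
  fixes \<Psi> :: "real \<Rightarrow> real"
  assumes step: "\<And>u b. 0 \<le> u \<Longrightarrow> 0 \<le> b \<Longrightarrow> b < 1 \<Longrightarrow> u + b\<^sup>2 \<le> 1 \<Longrightarrow> \<Psi> u - c * b ^ 3 \<le> \<Psi> (u + b\<^sup>2)"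
    and xy: "0 \<le> x" "x \<le> y" "y \<le> 1"
  shows "\<Psi> x \<le> \<Psi> y"
proof -
  define h where "h = y - x"
  have h: "0 \<le> h" "h \<le> 1" using xy by (auto simp: h_def)
  have bound: "\<Psi> x - c * h * sqrt (h / real n) \<le> \<Psi> y" if n: "n \<ge> 2" for n :: nat
  proof -
    define b where "b = sqrt (h / n)"
    have "h / n < 1" using h n by (simp add: field_simps)
    then have b: "0 \<le> b" "b < 1" "n * b\<^sup>2 = h" using h n by (auto simp: b_def)
    have "\<Psi> x - real k * (c * b ^ 3) \<le> \<Psi> (x + real k * b\<^sup>2)" if "k \<le> n" for k
      using that
    proof (induction k)
      case (Suc k)
      have "real (Suc k) * b\<^sup>2 \<le> h"
        using Suc.prems unfolding b(3)[symmetric] by (intro mult_right_mono) auto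
      then have "\<Psi> (x + real k * b\<^sup>2) - c * b ^ 3 \<le> \<Psi> (x + real k * b\<^sup>2 + b\<^sup>2)"
        using b xy by (intro step) (auto simp: h_def algebra_simps)
      with Suc show ?case by (simp add: algebra_simps)
    qed simp
    from this[of n] have "\<Psi> x - real n * (c * b ^ 3) \<le> \<Psi> y"
      using b(3) by (simp add: h_def)
    moreover have "real n * (c * b ^ 3) = c * (n * b\<^sup>2) * b"
      by (simp add: power2_eq_square power3_eq_cube)
    ultimately show ?thesis by (simp add: b(3) flip: b_def)
  qed
  have "(\<lambda>n. h / real n) \<longlonglongrightarrow> 0" by (rule lim_const_over_n)
  then have "(\<lambda>n. \<Psi> x - c * h * sqrt (h / real n)) \<longlonglongrightarrow> \<Psi> x - c * h * sqrt 0"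
    by (intro tendsto_intros)
  then have "(\<lambda>n. \<Psi> x - c * h * sqrt (h / real n)) \<longlonglongrightarrow> \<Psi> x" by simp
  moreover have "eventually (\<lambda>n. \<Psi> x - c * h * sqrt (h / real n) \<le> \<Psi> y) sequentially"
    by (rule eventually_mono[OF eventually_ge_at_top[of 2]]) (rule bound)
  ultimately show ?thesis
    by (rule tendsto_upperbound) simp
qed

text \<open>Integration of \<open>\<Phi>' = K \<ge> \<alpha> + \<beta> s\<close>, with \<open>\<Phi>' = K\<close> known only in the finite-difference form. The
  function \<open>\<Phi>\<close> minus the primitive of the affine bound is monotone.\<close>

lemma increment_ge_of_affine_bound:
  fixes \<Phi> K :: "real \<Rightarrow> real"
  assumes step: "\<And>s a b. 0 \<le> s \<Longrightarrow> s \<le> 1 \<Longrightarrow> 0 \<le> a \<Longrightarrow> 0 \<le> b \<Longrightarrow> a\<^sup>2 + b\<^sup>2 = 1 \<Longrightarrow>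
      \<bar>\<Phi> (a\<^sup>2 * s + b\<^sup>2) - \<Phi> (a\<^sup>2 * s) - b\<^sup>2 * a\<^sup>2 * K s\<bar> \<le> c * b ^ 3"
    and K: "\<And>s. 0 \<le> s \<Longrightarrow> s \<le> 1 \<Longrightarrow> \<alpha> + \<beta> * s \<le> K s"
    and xy: "0 \<le> x" "x \<le> y" "y \<le> 1"
  shows "\<alpha> * (y - x) + \<beta> * (y\<^sup>2 - x\<^sup>2) / 2 \<le> \<Phi> y - \<Phi> x"
proof -
  define \<Psi> where "\<Psi> t = \<Phi> t - \<alpha> * t - \<beta> * t\<^sup>2 / 2" for t
  have "\<Psi> x \<le> \<Psi> y"
  proof (rule superlinear_loss_mono[OF _ xy])
    fix u b :: real assume u: "0 \<le> u" and b: "0 \<le> b" "b < 1" and ub: "u + b\<^sup>2 \<le> 1"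
    define a where "a = sqrt (1 - b\<^sup>2)"
    have "b\<^sup>2 < 1" using b by (simp add: power_less_one_iff abs_square_less_1)
    then have a: "0 < a" "a\<^sup>2 = 1 - b\<^sup>2" by (auto simp: a_def)
    define s where "s = u / a\<^sup>2"
    have s: "0 \<le> s" "s \<le> 1" "a\<^sup>2 * s = u"
      using u a ub by (auto simp: s_def field_simps)
    have "b\<^sup>2 * a\<^sup>2 * (\<alpha> + \<beta> * s) \<le> b\<^sup>2 * a\<^sup>2 * K s"
      using K[OF s(1,2)] by (intro mult_left_mono) auto
    moreover have "b\<^sup>2 * a\<^sup>2 * K s - c * b ^ 3 \<le> \<Phi> (u + b\<^sup>2) - \<Phi> u"
    proof -
      have "a\<^sup>2 + b\<^sup>2 = 1" using a(2) by simp
      from step[OF s(1,2) less_imp_le[OF a(1)] b(1) this] show ?thesis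
        unfolding s(3) by linarith
    qed
    moreover have "b\<^sup>2 * a\<^sup>2 * (\<alpha> + \<beta> * s) = b\<^sup>2 * \<alpha> * a\<^sup>2 + b\<^sup>2 * \<beta> * (a\<^sup>2 * s)"
      by (simp add: algebra_simps)
    ultimately have "b\<^sup>2 * \<alpha> * (1 - b\<^sup>2) + b\<^sup>2 * \<beta> * u - c * b ^ 3 \<le> \<Phi> (u + b\<^sup>2) - \<Phi> u"
      unfolding s(3) unfolding a(2) by linarith
    moreover have "\<Psi> (u + b\<^sup>2) - \<Psi> u = \<Phi> (u + b\<^sup>2) - \<Phi> u - (b\<^sup>2 * \<alpha> + b\<^sup>2 * \<beta> * u + \<beta> * b ^ 4 / 2)"
      by (simp add: \<Psi>_def power2_eq_square power4_eq_xxxx algebra_simps add_divide_distrib)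
    moreover have "b\<^sup>2 * \<alpha> * (1 - b\<^sup>2) = b\<^sup>2 * \<alpha> - \<alpha> * b ^ 4"
      by (simp add: power2_eq_square power4_eq_xxxx algebra_simps)
    moreover have "(\<alpha> + \<beta> / 2) * b ^ 4 \<le> \<bar>\<alpha> + \<beta> / 2\<bar> * b ^ 3"
      using b by (intro mult_mono power_decreasing) auto
    ultimately show "\<Psi> u - (c + \<bar>\<alpha> + \<beta> / 2\<bar>) * b ^ 3 \<le> \<Psi> (u + b\<^sup>2)"
      by (simp add: algebra_simps)
  qed
  then show ?thesis by (simp add: \<Psi>_def algebra_simps diff_divide_distrib)
qed

text \<open>For a positively homogeneous gradient the dilation by \<open>a\<close> in the finite-difference identity comes
  out as the factor \<open>a\<^sup>2\<close>, so affine bounds on the noise stability of the gradient can be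
  integrated.\<close>

lemma noise_stability_increment:
  fixes F :: "real^'n \<Rightarrow> real" and D :: "real^'n \<Rightarrow> real^'n"
  assumes F: "F \<in> borel_measurable borel" and L: "L-lipschitz_on UNIV D"
    and taylor: "\<And>x h. \<bar>F (x + h) - F x - D x \<bullet> h\<bar> \<le> \<kappa> * (norm h)\<^sup>2"
    and homog: "\<And>a x. 0 \<le> a \<Longrightarrow> D (a *\<^sub>R x) = a *\<^sub>R D x"
    and xy: "0 \<le> x" "x \<le> y" "y \<le> 1"
  shows noise_stability_increment_ge:
      "(\<And>s. 0 \<le> s \<Longrightarrow> s \<le> 1 \<Longrightarrow> \<alpha> + \<beta> * s \<le> noise_stability D s) \<Longrightarrow>
       \<alpha> * (y - x) + \<beta> * (y\<^sup>2 - x\<^sup>2) / 2 \<le> noise_stability F y - noise_stability F x"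
    and noise_stability_increment_le:
      "(\<And>s. 0 \<le> s \<Longrightarrow> s \<le> 1 \<Longrightarrow> noise_stability D s \<le> \<alpha> + \<beta> * s) \<Longrightarrow>
       noise_stability F y - noise_stability F x \<le> \<alpha> * (y - x) + \<beta> * (y\<^sup>2 - x\<^sup>2) / 2"
proof -
  obtain c where c: "\<And>s a b. 0 \<le> s \<Longrightarrow> s \<le> 1 \<Longrightarrow> 0 \<le> a \<Longrightarrow> 0 \<le> b \<Longrightarrow> a\<^sup>2 + b\<^sup>2 = 1 \<Longrightarrow>
    \<bar>noise_stability F (a\<^sup>2 * s + b\<^sup>2) - noise_stability F (a\<^sup>2 * s)
      - b\<^sup>2 * noise_stability (\<lambda>x. D (a *\<^sub>R x)) s\<bar> \<le> c * b ^ 3"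
    using noise_stability_step[OF F L taylor] by blast
  have scale: "noise_stability (\<lambda>x. D (a *\<^sub>R x)) s = a\<^sup>2 * noise_stability D s" if "0 \<le> a" for a s
    unfolding noise_stability_def by (simp add: homog[OF that] power2_eq_square mult.assoc)
  have c': "\<bar>noise_stability F (a\<^sup>2 * s + b\<^sup>2) - noise_stability F (a\<^sup>2 * s)
      - b\<^sup>2 * a\<^sup>2 * noise_stability D s\<bar> \<le> c * b ^ 3"
    if "0 \<le> s" "s \<le> 1" "0 \<le> a" "0 \<le> b" "a\<^sup>2 + b\<^sup>2 = 1" for s a b
    using c[OF that] by (simp add: scale[OF that(3)] mult.assoc)
  show "\<alpha> * (y - x) + \<beta> * (y\<^sup>2 - x\<^sup>2) / 2 \<le> noise_stability F y - noise_stability F x"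
    if "\<And>s. 0 \<le> s \<Longrightarrow> s \<le> 1 \<Longrightarrow> \<alpha> + \<beta> * s \<le> noise_stability D s"
    using c' that xy by (rule increment_ge_of_affine_bound)
  show "noise_stability F y - noise_stability F x \<le> \<alpha> * (y - x) + \<beta> * (y\<^sup>2 - x\<^sup>2) / 2"
    if K: "\<And>s. 0 \<le> s \<Longrightarrow> s \<le> 1 \<Longrightarrow> noise_stability D s \<le> \<alpha> + \<beta> * s"
  proof -
    have "(- \<alpha>) * (y - x) + (- \<beta>) * (y\<^sup>2 - x\<^sup>2) / 2 \<le> - noise_stability F y - (- noise_stability F x)"
    proof (rule increment_ge_of_affine_bound[where K = "\<lambda>s. - noise_stability D s" and c = c, OF _ _ xy])
      fix s a b :: real assume "0 \<le> s" "s \<le> 1" "0 \<le> a" "0 \<le> b" "a\<^sup>2 + b\<^sup>2 = 1"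
      from c'[OF this] show "\<bar>- noise_stability F (a\<^sup>2 * s + b\<^sup>2) - - noise_stability F (a\<^sup>2 * s)
          - b\<^sup>2 * a\<^sup>2 * - noise_stability D s\<bar> \<le> c * b ^ 3"
        by (simp add: abs_le_iff algebra_simps)
    qed (use K in fastforce)
    then show ?thesis by (simp add: field_simps)
  qed
qed

section \<open>Projections onto closed convex cones\<close>

context
  fixes C :: "'a::euclidean_space set"
  assumes C: "closed C" "convex_cone C"
begin

lemma cone_facts: "C \<noteq> {}" "convex C" "\<And>t x. 0 \<le> t \<Longrightarrow> x \<in> C \<Longrightarrow> t *\<^sub>R x \<in> C"
  using C(2) convex_cone_scaleR[OF C(2)] by (simp_all add: convex_cone_def)

lemma closest_point_cone_mem: "closest_point C x \<in> C"
  by (rule closest_point_in_set[OF C(1) cone_facts(1)])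

lemma closest_point_cone_orthogonal: "(x - closest_point C x) \<bullet> closest_point C x = 0"
proof -
  let ?p = "closest_point C x"
  have *: "(x - ?p) \<bullet> (t *\<^sub>R ?p - ?p) \<le> 0" if "t \<ge> 0" for t
    by (rule closest_point_dot[OF cone_facts(2) C(1) cone_facts(3)[OF that closest_point_cone_mem]])
  show ?thesis using *[of 0] *[of 2] by (simp add: algebra_simps inner_diff_right scaleR_2)
qed

text \<open>The residual \<open>x - closest_point C x\<close> lies in the polar cone.\<close>

lemma inner_closest_point_cone_le:
  assumes "c \<in> C"
  shows "c \<bullet> x \<le> c \<bullet> closest_point C x"
proof -
  have "(x - closest_point C x) \<bullet> (c - closest_point C x) \<le> 0"
    by (rule closest_point_dot[OF cone_facts(2) C(1) assms])
  then show ?thesis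
    using closest_point_cone_orthogonal[of x]
    by (simp add: inner_diff_left inner_diff_right inner_commute)
qed

lemma inner_closest_point_cone_self: "closest_point C x \<bullet> x = (norm (closest_point C x))\<^sup>2"
  using closest_point_cone_orthogonal[of x]
  by (simp add: inner_diff_left inner_diff_right power2_norm_eq_inner inner_commute)

lemma lipschitz_closest_point_cone: "1-lipschitz_on UNIV (closest_point C)"
proof (rule lipschitz_onI)
  show "dist (closest_point C x) (closest_point C y) \<le> 1 * dist x y" for x y
    using closest_point_lipschitz[OF cone_facts(2) C(1) cone_facts(1), of x y] by simp
qed simp

lemma closest_point_cone_scaleR:
  assumes "0 \<le> a"
  shows "closest_point C (a *\<^sub>R x) = a *\<^sub>R closest_point C x"
proof (rule closest_point_unique[symmetric])
  let ?p = "closest_point C x"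
  show "convex C" "closed C" by (rule cone_facts C)+
  show "a *\<^sub>R ?p \<in> C"
    by (rule cone_facts(3)[OF assms closest_point_cone_mem])
  show "\<forall>z\<in>C. dist (a *\<^sub>R x) (a *\<^sub>R ?p) \<le> dist (a *\<^sub>R x) z"
  proof
    fix z assume z: "z \<in> C"
    have "(a *\<^sub>R x - a *\<^sub>R ?p) \<bullet> (z - a *\<^sub>R ?p) = a * ((x - ?p) \<bullet> z) - a * a * ((x - ?p) \<bullet> ?p)"
      by (simp add: inner_diff_right flip: scaleR_diff_right)
    also have "(x - ?p) \<bullet> z \<le> 0"
      using inner_closest_point_cone_le[OF z, of x] by (simp add: inner_diff_left inner_diff_right inner_commute)
    then have "a * ((x - ?p) \<bullet> z) - a * a * ((x - ?p) \<bullet> ?p) \<le> 0"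
      using assms by (simp add: closest_point_cone_orthogonal mult_nonneg_nonpos)
    finally have "(a *\<^sub>R x - a *\<^sub>R ?p) \<bullet> (z - a *\<^sub>R ?p) \<le> 0" .
    moreover have "2 * ((a *\<^sub>R x - a *\<^sub>R ?p) \<bullet> (z - a *\<^sub>R ?p))
        = (norm (a *\<^sub>R x - a *\<^sub>R ?p))\<^sup>2 + (norm (z - a *\<^sub>R ?p))\<^sup>2 - (norm (a *\<^sub>R x - z))\<^sup>2"
      by (simp add: dot_norm_neg)
    ultimately have "(norm (a *\<^sub>R x - a *\<^sub>R ?p))\<^sup>2 \<le> (norm (a *\<^sub>R x - z))\<^sup>2"
      using zero_le_power2[of "norm (z - a *\<^sub>R ?p)"] by linarith
    then show "dist (a *\<^sub>R x) (a *\<^sub>R ?p) \<le> dist (a *\<^sub>R x) z"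
      unfolding dist_norm by (rule power2_le_imp_le) simp
  qed
qed

text \<open>The squared norm of the projection is the maximum over \<open>c \<in> C\<close> of the functions
  \<open>2 (c \<bullet> x) - (norm c)\<^sup>2\<close>, which are affine in \<open>x\<close>; the maximum is attained at the projection itself.\<close>

lemma norm_closest_point_cone_sq_ge:
  assumes "c \<in> C"
  shows "2 * (c \<bullet> x) - (norm c)\<^sup>2 \<le> (norm (closest_point C x))\<^sup>2"
proof -
  have "2 * (c \<bullet> closest_point C x) = (norm c)\<^sup>2 + (norm (closest_point C x))\<^sup>2 - (norm (c - closest_point C x))\<^sup>2"
    by (simp add: dot_norm_neg)
  then show ?thesis
    using inner_closest_point_cone_le[OF assms, of x] zero_le_power2[of "norm (c - closest_point C x)"]
    by linarith
qed

text \<open>The squared norm of the projection has gradient \<open>2 *\<^sub>R closest_point C\<close>. The maximisers at the two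
  endpoints serve as test points for the variational formula at the other endpoint, and the projection is
  1-Lipschitz.\<close>

lemma norm_closest_point_cone_sq_taylor:
  "\<bar>(norm (closest_point C (x + h)))\<^sup>2 - (norm (closest_point C x))\<^sup>2 - (2 *\<^sub>R closest_point C x) \<bullet> h\<bar>
    \<le> 2 * (norm h)\<^sup>2"
proof -
  let ?p = "closest_point C x" and ?q = "closest_point C (x + h)"
  have "2 * (?p \<bullet> (x + h)) - (norm ?p)\<^sup>2 \<le> (norm ?q)\<^sup>2"
    by (rule norm_closest_point_cone_sq_ge) (rule closest_point_cone_mem)
  then have lower: "(norm ?p)\<^sup>2 + 2 * (?p \<bullet> h) \<le> (norm ?q)\<^sup>2"
    by (simp add: inner_add_right inner_closest_point_cone_self)
  have "2 * (?q \<bullet> x) - (norm ?q)\<^sup>2 \<le> (norm ?p)\<^sup>2"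
    by (rule norm_closest_point_cone_sq_ge) (rule closest_point_cone_mem)
  then have upper: "(norm ?q)\<^sup>2 \<le> (norm ?p)\<^sup>2 + 2 * (?q \<bullet> h)"
    using inner_closest_point_cone_self[of "x + h"] by (simp add: inner_add_right)
  have "(?q - ?p) \<bullet> h \<le> norm (?q - ?p) * norm h" by (rule norm_cauchy_schwarz)
  also have "\<dots> \<le> norm h * norm h"
    using lipschitz_onD[OF lipschitz_closest_point_cone, of "x + h" x]
    by (intro mult_right_mono) (auto simp: dist_norm)
  finally have "?q \<bullet> h \<le> ?p \<bullet> h + (norm h)\<^sup>2"
    by (simp add: inner_diff_left power2_eq_square)
  with lower upper show ?thesis
    by (simp add: abs_le_iff)
qed

end

text \<open>Replacing the second projection by the vector itself can only decrease the inner product with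
  a point of the cone, and what remains is linear in the second vector.\<close>

lemma noise_stability_closest_point_cone_ge:
  fixes C :: "(real^'n) set"
  assumes C: "closed C" "convex_cone C" and s: "0 \<le> s" "s \<le> 1"
  shows "s * noise_stability (closest_point C) 1 \<le> noise_stability (closest_point C) s"
proof -
  let ?P = "closest_point C"
  note lip = lipschitz_std_gaussian[OF lipschitz_closest_point_cone[OF C]]
  have id: "1-lipschitz_on UNIV (\<lambda>x::real^'n. x)" by (rule lipschitz_onI) auto
  note lip_id = lipschitz_std_gaussian[OF id]
  have int: "integrable (correlated_gaussian s) (\<lambda>p. ?P (fst p) \<bullet> snd p)"
    using integrable_correlated_gaussian_inner[OF s lip(1) lip_id(1) lip(3) lip_id(3)] .
  have inner: "(\<integral>y. ?P x \<bullet> (s *\<^sub>R x + sqrt (1 - s\<^sup>2) *\<^sub>R y) \<partial>std_gaussian) = s * (norm (?P x))\<^sup>2" for x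
  proof -
    have "integrable std_gaussian (\<lambda>y. ?P x \<bullet> y)" using lip_id(2) by simp
    then show ?thesis
      by (simp add: inner_add_right integral_std_gaussian_inner inner_closest_point_cone_self[OF C]
          std_gaussian.prob_space[simplified])
  qed
  have "s * noise_stability ?P 1 = (\<integral>p. ?P (fst p) \<bullet> snd p \<partial>correlated_gaussian s)"
    unfolding integral_correlated_gaussian(1)[OF int] noise_stability_0_1(2)[OF lip] by (simp add: inner)
  also have "\<dots> \<le> (\<integral>p. ?P (fst p) \<bullet> ?P (snd p) \<partial>correlated_gaussian s)"
  proof (rule integral_mono[OF int])
    show "integrable (correlated_gaussian s) (\<lambda>p. ?P (fst p) \<bullet> ?P (snd p))"
      by (rule integrable_correlated_gaussian_inner[OF s lip(1) lip(1) lip(3) lip(3)])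
    show "?P (fst p) \<bullet> snd p \<le> ?P (fst p) \<bullet> ?P (snd p)" for p
      by (rule inner_closest_point_cone_le[OF C closest_point_cone_mem[OF C]])
  qed
  finally show ?thesis by (simp add: noise_stability_def)
qed

text \<open>Integration of the bounds on the noise stability of the projection. The lower bound combines the
  constant \<open>v\<close> and the line \<open>s \<delta>\<close>, which cross at \<open>s = v / \<delta>\<close>.\<close>

lemma variance_norm_closest_point_cone_sq_bounds:
  fixes C :: "(real^'n) set"
  assumes C: "closed C" "convex_cone C"
  defines "F \<equiv> \<lambda>x. (norm (closest_point C x))\<^sup>2"
    and "v \<equiv> noise_stability (closest_point C) 0" and "\<delta> \<equiv> noise_stability (closest_point C) 1"
  shows "noise_stability F 1 - noise_stability F 0 \<le> 2 * \<delta> + 2 * v"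
    and "0 < \<delta> \<Longrightarrow> 2 * \<delta> + 2 * v\<^sup>2 / \<delta> \<le> noise_stability F 1 - noise_stability F 0"
proof -
  let ?P = "closest_point C"
  define D where "D x = 2 *\<^sub>R ?P x" for x
  note lip = lipschitz_closest_point_cone[OF C]
  have F: "F \<in> borel_measurable borel"
    unfolding F_def using lipschitz_std_gaussian(1)[OF lip] by measurable
  have D: "2-lipschitz_on UNIV D"
    using lip unfolding lipschitz_on_def D_def by (simp add: dist_norm flip: scaleR_diff_right)
  have taylor: "\<bar>F (x + h) - F x - D x \<bullet> h\<bar> \<le> 2 * (norm h)\<^sup>2" for x h
    unfolding F_def D_def by (rule norm_closest_point_cone_sq_taylor[OF C])
  have homog: "D (a *\<^sub>R x) = a *\<^sub>R D x" if "0 \<le> a" for a x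
    using that by (simp add: D_def closest_point_cone_scaleR[OF C])
  have NS_D: "noise_stability D s = 4 * noise_stability ?P s" for s
    by (simp add: noise_stability_def D_def)
  note inc_ge = noise_stability_increment_ge[OF F D taylor homog]
  note inc_le = noise_stability_increment_le[OF F D taylor homog]
  have v0: "0 \<le> v"
    unfolding v_def noise_stability_0_1(1)[OF lipschitz_std_gaussian[OF lip]] by simp
  have v_le: "v \<le> \<delta>"
    using noise_stability_bounds(1)[OF lip, of 1] by (simp add: v_def \<delta>_def)
  have "noise_stability F 1 - noise_stability F 0 \<le> 4 * v * (1 - 0) + 4 * (\<delta> - v) * (1\<^sup>2 - 0\<^sup>2) / 2"
  proof (rule inc_le)
    fix s :: real assume s: "0 \<le> s" "s \<le> 1"
    show "noise_stability D s \<le> 4 * v + 4 * (\<delta> - v) * s"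
      using noise_stability_bounds(2)[OF lip s] by (simp add: NS_D v_def \<delta>_def algebra_simps)
  qed auto
  then show "noise_stability F 1 - noise_stability F 0 \<le> 2 * \<delta> + 2 * v"
    by (simp add: field_simps)
  show "2 * \<delta> + 2 * v\<^sup>2 / \<delta> \<le> noise_stability F 1 - noise_stability F 0" if \<delta>: "0 < \<delta>"
  proof -
    define c where "c = v / \<delta>"
    have c: "0 \<le> c" "c \<le> 1" using v0 v_le \<delta> by (auto simp: c_def)
    have "4 * v * (c - 0) + 0 * (c\<^sup>2 - 0\<^sup>2) / 2 \<le> noise_stability F c - noise_stability F 0"
      using noise_stability_bounds(1)[OF lip] c by (intro inc_ge) (auto simp: NS_D v_def)
    moreover have "0 * (1 - c) + 4 * \<delta> * (1\<^sup>2 - c\<^sup>2) / 2 \<le> noise_stability F 1 - noise_stability F c"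
      using noise_stability_closest_point_cone_ge[OF C] c
      by (intro inc_ge) (auto simp: NS_D \<delta>_def mult.commute)
    ultimately have "4 * v * c + 2 * \<delta> * (1 - c\<^sup>2) \<le> noise_stability F 1 - noise_stability F 0"
      by simp
    moreover have "4 * v * c + 2 * \<delta> * (1 - c\<^sup>2) = 2 * \<delta> + 2 * v\<^sup>2 / \<delta>"
      using \<delta> by (simp add: c_def field_simps power2_eq_square)
    ultimately show ?thesis by simp
  qed
qed

section \<open>Conic intrinsic volumes\<close>

lemma prob_space_chi_squared: "prob_space (chi_squared j)"
proof -
  interpret N: prob_space std_normal_distribution by (rule prob_space_std_normal)
  interpret P: product_prob_space "\<lambda>_::nat. std_normal_distribution" "{..<j}" ..
  show ?thesis
    unfolding chi_squared_def by (rule P.prob_space_distr) measurable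
qed

lemma sets_chi_squared [simp, measurable_cong]: "sets (chi_squared j) = sets borel"
  by (simp add: chi_squared_def)

lemma chi_squared_moments:
  "integrable (chi_squared j) (\<lambda>t. t)" "(\<integral>t. t \<partial>chi_squared j) = real j"
  "integrable (chi_squared j) (\<lambda>t. t\<^sup>2)" "(\<integral>t. t\<^sup>2 \<partial>chi_squared j) = real j ^ 2 + 2 * real j"
proof -
  interpret N: prob_space std_normal_distribution by (rule prob_space_std_normal)
  interpret P: product_prob_space "\<lambda>_::nat. std_normal_distribution" "{..<j}" ..
  let ?P = "Pi\<^sub>M {..<j} (\<lambda>_. std_normal_distribution)"
  define e where "e i l t = (if l = i then t\<^sup>2 else 1)" for i l :: nat and t :: real
  have pow: "integrable std_normal_distribution (\<lambda>t. t ^ k)" for k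
    by (rule std_normal_moments)
  have m2: "(\<integral>t. t\<^sup>2 \<partial>std_normal_distribution) = 1"
    by (rule std_normal_moments)
  have m4: "(\<integral>t. t ^ 4 \<partial>std_normal_distribution) = 3"
    by (rule std_normal_moments)
  have one: "(\<integral>t. 1 \<partial>std_normal_distribution) = (1::real)"
    using N.prob_space by simp
  have e1: "integrable std_normal_distribution (e i l)" "(\<integral>t. e i l t \<partial>std_normal_distribution) = 1" for i l
  proof -
    have "e i l = (\<lambda>t. t\<^sup>2) \<or> e i l = (\<lambda>t. 1)" by (cases "l = i") (auto simp: e_def fun_eq_iff)
    then show "integrable std_normal_distribution (e i l)" "(\<integral>t. e i l t \<partial>std_normal_distribution) = 1"
      using pow[of 2] m2 one by auto
  qed
  have sq4: "t\<^sup>2 * t\<^sup>2 = t ^ 4" for t :: real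
    by (simp add: power2_eq_square power4_eq_xxxx)
  have e2: "integrable std_normal_distribution (\<lambda>t. e i l t * e k l t)"
    "(\<integral>t. e i l t * e k l t \<partial>std_normal_distribution) = (if l = i \<and> l = k then 3 else 1)" for i k l
  proof -
    have "(\<lambda>t. e i l t * e k l t) = (if l = i \<and> l = k then (\<lambda>t. t ^ 4) else if l = i \<or> l = k then (\<lambda>t. t\<^sup>2) else (\<lambda>t. 1))"
      by (auto simp: e_def sq4)
    then show "integrable std_normal_distribution (\<lambda>t. e i l t * e k l t)"
      "(\<integral>t. e i l t * e k l t \<partial>std_normal_distribution) = (if l = i \<and> l = k then 3 else 1)"
      using pow[of 2] pow[of 4] m2 m4 one by simp_all
  qed
  have single: "(\<Prod>l<j. e i l (x l)) = (x i)\<^sup>2" if "i < j" for i and x :: "nat \<Rightarrow> real"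
    using that by (simp add: e_def prod.delta)
  have pair: "(\<Prod>l<j. e i l (x l) * e k l (x l)) = (x i)\<^sup>2 * (x k)\<^sup>2" if "i < j" "k < j" for i k and x :: "nat \<Rightarrow> real"
    using that by (simp add: prod.distrib single)
  have i1: "integrable ?P (\<lambda>x. (x i)\<^sup>2)" and v1: "(\<integral>x. (x i)\<^sup>2 \<partial>?P) = 1" if "i < j" for i
    using P.product_integrable_prod[of "{..<j}" "e i"] P.product_integral_prod[of "{..<j}" "e i"] e1
    by (simp_all add: single[OF that])
  have i2: "integrable ?P (\<lambda>x. (x i)\<^sup>2 * (x k)\<^sup>2)"
    and v2: "(\<integral>x. (x i)\<^sup>2 * (x k)\<^sup>2 \<partial>?P) = (if i = k then 3 else 1)" if "i < j" "k < j" for i k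
  proof -
    show "integrable ?P (\<lambda>x. (x i)\<^sup>2 * (x k)\<^sup>2)"
      using P.product_integrable_prod[of "{..<j}" "\<lambda>l t. e i l t * e k l t"] e2
      by (simp add: pair[OF that])
    have "(\<integral>x. (x i)\<^sup>2 * (x k)\<^sup>2 \<partial>?P) = (\<Prod>l<j. if l = i \<and> l = k then 3 else 1)"
      using P.product_integral_prod[of "{..<j}" "\<lambda>l t. e i l t * e k l t"] e2
      by (simp add: pair[OF that])
    also have "\<dots> = (if i = k then 3 else 1)"
      using that by (cases "i = k") (auto simp: prod.delta intro!: prod.neutral)
    finally show "(\<integral>x. (x i)\<^sup>2 * (x k)\<^sup>2 \<partial>?P) = (if i = k then 3 else 1)" .
  qed
  have sq: "(\<Sum>i<j. (x i)\<^sup>2)\<^sup>2 = (\<Sum>i<j. \<Sum>k<j. (x i)\<^sup>2 * (x k)\<^sup>2)" for x :: "nat \<Rightarrow> real"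
    by (simp add: power2_eq_square sum_product)
  show "integrable (chi_squared j) (\<lambda>t. t)"
    unfolding chi_squared_def by (subst integrable_distr_eq) (auto intro!: i1)
  show "integrable (chi_squared j) (\<lambda>t. t\<^sup>2)"
    unfolding chi_squared_def by (subst integrable_distr_eq) (auto simp: sq intro!: i2)
  show "(\<integral>t. t \<partial>chi_squared j) = real j"
    unfolding chi_squared_def by (subst integral_distr) (auto simp: i1 v1)
  have "(\<integral>t. t\<^sup>2 \<partial>chi_squared j) = (\<integral>x. (\<Sum>i<j. \<Sum>k<j. (x i)\<^sup>2 * (x k)\<^sup>2) \<partial>?P)"
    unfolding chi_squared_def by (subst integral_distr) (auto simp: sq)
  also have "\<dots> = (\<Sum>i<j. \<integral>x. (\<Sum>k<j. (x i)\<^sup>2 * (x k)\<^sup>2) \<partial>?P)"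
    by (rule Bochner_Integration.integral_sum) (auto intro!: Bochner_Integration.integrable_sum i2)
  also have "\<dots> = (\<Sum>i<j. \<Sum>k<j. \<integral>x. (x i)\<^sup>2 * (x k)\<^sup>2 \<partial>?P)"
    by (intro sum.cong refl Bochner_Integration.integral_sum) (auto intro!: i2)
  also have "\<dots> = (\<Sum>i<j. \<Sum>k<j. if i = k then 3 else 1)"
    by (simp add: v2)
  also have "\<dots> = (\<Sum>i<j. \<Sum>k<j. 1 + (if i = k then 2 else 0))"
    by (intro sum.cong) auto
  also have "\<dots> = real j ^ 2 + 2 * real j"
    by (simp add: sum.distrib power2_eq_square algebra_simps)
  finally show "(\<integral>t. t\<^sup>2 \<partial>chi_squared j) = real j ^ 2 + 2 * real j" .
qed

text \<open>The defining identity of the intrinsic volumes, extended from bounded test functions to integrable ones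
  by truncation and dominated convergence, and specialised to functions of the first component.\<close>

lemma integral_intrinsic_volumes:
  fixes C :: "(real^'n) set"
  assumes w: "intrinsic_volumes C w" and [measurable]: "f \<in> borel_measurable borel"
    and P [measurable]: "closest_point C \<in> borel_measurable borel"
    and int: "integrable std_gaussian (\<lambda>x. f ((norm (closest_point C x))\<^sup>2))"
    and chi: "\<And>j. integrable (chi_squared j) f"
  shows "(\<integral>x. f ((norm (closest_point C x))\<^sup>2) \<partial>std_gaussian) = (\<Sum>j\<le>CARD('n). w j * (\<integral>t. f t \<partial>chi_squared j))"
proof -
  define F where "F n t = max (- real n) (min (real n) (f t))" for n t
  have [measurable]: "F n \<in> borel_measurable borel" for n
    unfolding F_def by measurable
  have F_le: "\<bar>F n t\<bar> \<le> \<bar>f t\<bar>" for n t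
    unfolding F_def by auto
  have F_lim: "(\<lambda>n. F n t) \<longlonglongrightarrow> f t" for t
  proof (rule tendsto_eventually)
    obtain m :: nat where m: "\<bar>f t\<bar> \<le> real m" using real_arch_simple by blast
    show "eventually (\<lambda>n. F n t = f t) sequentially"
    proof (rule eventually_sequentiallyI)
      fix n assume "m \<le> n"
      then have "\<bar>f t\<bar> \<le> real n" using m by linarith
      then show "F n t = f t" unfolding F_def by auto
    qed
  qed
  have F_eq: "(\<integral>x. F n ((norm (closest_point C x))\<^sup>2) \<partial>std_gaussian) = (\<Sum>j\<le>CARD('n). w j * (\<integral>t. F n t \<partial>chi_squared j))" for n
  proof -
    have "(\<lambda>y::real \<times> real. F n (fst y)) \<in> borel_measurable borel"
      unfolding borel_prod[symmetric] by measurable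
    moreover have "bounded (range (\<lambda>y::real \<times> real. F n (fst y)))"
      unfolding bounded_iff by (intro exI[of _ "real n"]) (auto simp: F_def)
    moreover have "(\<integral>y. F n (fst y) \<partial>(chi_squared j \<Otimes>\<^sub>M chi_squared (CARD('n) - j))) = (\<integral>t. F n t \<partial>chi_squared j)" for j
    proof -
      interpret Y: prob_space "chi_squared (CARD('n) - j)" by (rule prob_space_chi_squared)
      have "(\<integral>y. F n (fst y) \<partial>(chi_squared j \<Otimes>\<^sub>M chi_squared (CARD('n) - j)))
          = (\<integral>t. F n t \<partial>distr (chi_squared j \<Otimes>\<^sub>M chi_squared (CARD('n) - j)) (chi_squared j) fst)"
        by (subst integral_distr) auto
      then show ?thesis by (simp add: Y.distr_pair_fst)
    qed
    ultimately show ?thesis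
      using w[unfolded intrinsic_volumes_def, THEN conjunct2, THEN conjunct2, rule_format, of "\<lambda>y. F n (fst y)"]
      by simp
  qed
  have "(\<lambda>n. \<integral>x. F n ((norm (closest_point C x))\<^sup>2) \<partial>std_gaussian)
      \<longlonglongrightarrow> (\<integral>x. f ((norm (closest_point C x))\<^sup>2) \<partial>std_gaussian)"
    by (rule integral_dominated_convergence[OF _ _ integrable_abs[OF int]]) (use F_lim F_le in auto)
  moreover have "(\<lambda>n. \<Sum>j\<le>CARD('n). w j * (\<integral>t. F n t \<partial>chi_squared j)) \<longlonglongrightarrow> (\<Sum>j\<le>CARD('n). w j * (\<integral>t. f t \<partial>chi_squared j))"
    by (intro tendsto_sum tendsto_mult_left integral_dominated_convergence[OF _ _ integrable_abs[OF chi]])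
       (use F_lim F_le in auto)
  ultimately show ?thesis
    unfolding F_eq by (rule LIMSEQ_unique)
qed

text \<open>A chi-squared variable with \<open>j\<close> degrees of freedom has mean \<open>j\<close> and second moment \<open>j\<^sup>2 + 2 j\<close>. For a
  random number of degrees of freedom, the variance therefore exceeds that of the number
  of degrees of freedom by twice its mean.\<close>

lemma intrinsic_volumes_moments:
  fixes C :: "(real^'n) set"
  assumes C: "closed C" "convex_cone C" and w: "intrinsic_volumes C w"
  defines "F \<equiv> \<lambda>x. (norm (closest_point C x))\<^sup>2"
  shows "(\<Sum>j\<le>CARD('n). w j * real j) = statistical_dimension C"
    and "(\<Sum>j\<le>CARD('n). w j * real j ^ 2) - (\<Sum>j\<le>CARD('n). w j * real j)\<^sup>2
      = noise_stability F 1 - noise_stability F 0 - 2 * statistical_dimension C"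
proof -
  let ?S = "\<lambda>f. \<Sum>j\<le>CARD('n). w j * f j"
  note lip = lipschitz_std_gaussian[OF lipschitz_closest_point_cone[OF C]]
  have [measurable]: "F \<in> borel_measurable borel"
    unfolding F_def using lip(1) by measurable
  have F1: "integrable std_gaussian F"
    using lip(3) by (simp add: F_def)
  have F2: "integrable std_gaussian (\<lambda>x. (F x)\<^sup>2)"
  proof (rule integrable_quadratic_remainder(2)[where c = 0 and u = 0 and \<kappa> = 2])
    have "F 0 = 0"
      using closest_point_cone_scaleR[OF C, of 0 0] by (simp add: F_def)
    moreover have "closest_point C 0 = 0"
      using closest_point_cone_scaleR[OF C, of 0 0] by simp
    ultimately show "\<bar>F z - 0 - 0 \<bullet> z\<bar> \<le> 2 * (norm z)\<^sup>2" for z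
      using norm_closest_point_cone_sq_taylor[OF C, of 0 z] by (simp add: F_def)
  qed simp
  have meas: "(\<lambda>t::real. t) \<in> borel_measurable borel" "(\<lambda>t::real. t\<^sup>2) \<in> borel_measurable borel"
    by measurable
  have E1: "(\<integral>x. F x \<partial>std_gaussian) = ?S real"
    using integral_intrinsic_volumes[OF w meas(1) lip(1) F1[unfolded F_def] chi_squared_moments(1)]
    by (simp add: F_def chi_squared_moments(2))
  have E2: "(\<integral>x. (F x)\<^sup>2 \<partial>std_gaussian) = ?S (\<lambda>j. real j ^ 2 + 2 * real j)"
    using integral_intrinsic_volumes[OF w meas(2) lip(1) F2[unfolded F_def] chi_squared_moments(3)]
    by (simp add: F_def chi_squared_moments(4))
  show S1: "?S real = statistical_dimension C"
    using E1 by (simp add: statistical_dimension_def F_def)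
  have "noise_stability F 1 - noise_stability F 0 = (\<integral>x. (F x)\<^sup>2 \<partial>std_gaussian) - (\<integral>x. F x \<partial>std_gaussian)\<^sup>2"
    using noise_stability_0_1[OF _ F1] F2 by simp
  also have "\<dots> = ?S (\<lambda>j. real j ^ 2) + 2 * ?S real - (?S real)\<^sup>2"
  proof -
    have "?S (\<lambda>j. real j ^ 2 + 2 * real j) = ?S (\<lambda>j. real j ^ 2) + (\<Sum>j\<le>CARD('n). 2 * (w j * real j))"
      unfolding sum.distrib[symmetric] by (intro sum.cong) (auto simp: algebra_simps)
    then show ?thesis unfolding E1 E2 by (simp only: sum_distrib_left)
  qed
  finally show "?S (\<lambda>j. real j ^ 2) - (?S real)\<^sup>2 = noise_stability F 1 - noise_stability F 0 - 2 * statistical_dimension C"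
    by (simp add: S1)
qed

lemma (in prob_space) expectation_of_nat_valued:
  fixes V :: "'a \<Rightarrow> nat" and h :: "nat \<Rightarrow> real"
  assumes V [measurable]: "V \<in> measurable M (count_space UNIV)"
    and law: "\<And>j. j \<le> d \<Longrightarrow> prob {\<omega> \<in> space M. V \<omega> = j} = w j"
    and sum: "(\<Sum>j\<le>d. w j) = 1"
  shows "expectation (\<lambda>\<omega>. h (V \<omega>)) = (\<Sum>j\<le>d. w j * h j)"
proof -
  define A where "A j = {\<omega> \<in> space M. V \<omega> = j}" for j
  have A [measurable]: "A j \<in> events" for j unfolding A_def by measurable
  have "prob (\<Union>j\<le>d. A j) = (\<Sum>j\<le>d. prob (A j))"
    by (rule finite_measure_finite_Union) (auto simp: disjoint_family_on_def A_def)
  also have "\<dots> = 1" using law sum by (simp add: A_def)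
  finally have "AE \<omega> in M. \<omega> \<in> (\<Union>j\<le>d. A j)" by (subst (asm) prob_eq_1) auto
  then have "expectation (\<lambda>\<omega>. h (V \<omega>)) = expectation (\<lambda>\<omega>. \<Sum>j\<le>d. h j * indicator (A j) \<omega>)"
  proof (intro integral_cong_AE, goal_cases)
    case 3
    then show ?case
    proof eventually_elim
      case (elim \<omega>)
      then have "V \<omega> \<le> d" "\<omega> \<in> space M" by (auto simp: A_def)
      then have "(\<Sum>j\<le>d. h j * indicator (A j) \<omega>) = (\<Sum>j\<le>d. if j = V \<omega> then h j else 0)"
        by (intro sum.cong) (auto simp: A_def indicator_def)
      then show ?case using \<open>V \<omega> \<le> d\<close> by (simp add: sum.delta)
    qed
  qed measurable
  also have "\<dots> = (\<Sum>j\<le>d. h j * prob (A j))"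
    by (subst Bochner_Integration.integral_sum)
       (simp_all add: integrable_real_indicator emeasure_eq_measure)
  also have "\<dots> = (\<Sum>j\<le>d. w j * h j)" using law by (simp add: A_def mult.commute)
  finally show ?thesis .
qed

lemma (in prob_space) variance_of_nat_valued:
  fixes V :: "'a \<Rightarrow> nat"
  assumes "V \<in> measurable M (count_space UNIV)"
    and "\<And>j. j \<le> d \<Longrightarrow> prob {\<omega> \<in> space M. V \<omega> = j} = w j"
    and "(\<Sum>j\<le>d. w j) = 1"
  shows "variance (\<lambda>\<omega>. real (V \<omega>)) = (\<Sum>j\<le>d. w j * real j ^ 2) - (\<Sum>j\<le>d. w j * real j)\<^sup>2"
proof -
  define \<mu> where "\<mu> = (\<Sum>j\<le>d. w j * real j)"
  note E = expectation_of_nat_valued[OF assms]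
  have "expectation (\<lambda>\<omega>. real (V \<omega>)) = \<mu>"
    using E[of real] by (simp add: \<mu>_def)
  then have "variance (\<lambda>\<omega>. real (V \<omega>)) = (\<Sum>j\<le>d. w j * (real j - \<mu>)\<^sup>2)"
    using E[of "\<lambda>j. (real j - \<mu>)\<^sup>2"] by simp
  also have "\<dots> = (\<Sum>j\<le>d. w j * real j ^ 2 - 2 * \<mu> * (w j * real j) + \<mu>\<^sup>2 * w j)"
    by (intro sum.cong) (auto simp: power2_eq_square algebra_simps)
  also have "\<dots> = (\<Sum>j\<le>d. w j * real j ^ 2) - 2 * \<mu> * \<mu> + \<mu>\<^sup>2 * 1"
    unfolding sum.distrib sum_subtractf sum_distrib_left[symmetric] \<mu>_def[symmetric] assms(3) ..
  finally show ?thesis by (simp add: \<mu>_def power2_eq_square)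
qed

theorem theorem4p1:
  fixes C :: "(real ^ 'n) set"
    and M :: "'a measure" and g :: "'a \<Rightarrow> real ^ 'n"
    and w :: "nat \<Rightarrow> real"
    and N :: "'b measure" and V :: "'b \<Rightarrow> nat"
    and v b :: real
  assumes "closed C" and "convex_cone C"
    and "prob_space M" and "g \<in> borel_measurable M" and "distr M borel g = std_gaussian"
    and "intrinsic_volumes C w"
    and "prob_space N" and "V \<in> measurable N (count_space UNIV)"
    and "\<forall>j\<le>CARD('n). measure N {\<omega> \<in> space N. V \<omega> = j} = w j"
    and "v = (norm (\<integral>\<omega>. closest_point C (g \<omega>) \<partial>M))\<^sup>2"
    and "b = sqrt (real CARD('n) * statistical_dimension C / 2)"
  shows "min (v\<^sup>2) (4 * b\<^sup>2) / b \<le> prob_space.variance N (\<lambda>\<omega>. real (V \<omega>))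
    \<and> prob_space.variance N (\<lambda>\<omega>. real (V \<omega>)) \<le> 2 * v"
proof -
  interpret N: prob_space N by fact
  note C = assms(1,2) and w = assms(6)
  let ?d = "real CARD('n)" and ?F = "\<lambda>x. (norm (closest_point C x))\<^sup>2"
  define \<delta> where "\<delta> = statistical_dimension C"
  note lip = lipschitz_std_gaussian[OF lipschitz_closest_point_cone[OF C]]
  have \<delta>: "noise_stability (closest_point C) 1 = \<delta>"
    by (simp add: noise_stability_0_1(2)[OF lip] \<delta>_def statistical_dimension_def)
  have "(\<integral>\<omega>. closest_point C (g \<omega>) \<partial>M) = (\<integral>x. closest_point C x \<partial>std_gaussian)"
    unfolding assms(5)[symmetric] by (rule integral_distr[symmetric]) (use assms(4) lip(1) in auto)
  then have v: "noise_stability (closest_point C) 0 = v"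
    by (simp add: noise_stability_0_1(1)[OF lip] assms(10))
  have w_nonneg: "\<And>j. j \<le> CARD('n) \<Longrightarrow> 0 \<le> w j" and w_sum: "(\<Sum>j\<le>CARD('n). w j) = 1"
    using w by (auto simp: intrinsic_volumes_def)
  have var: "N.variance (\<lambda>\<omega>. real (V \<omega>)) = noise_stability ?F 1 - noise_stability ?F 0 - 2 * \<delta>"
    using N.variance_of_nat_valued[OF assms(8) _ w_sum] assms(9) intrinsic_volumes_moments(2)[OF C w]
    by (simp add: \<delta>_def)
  note bounds = variance_norm_closest_point_cone_sq_bounds[OF C, unfolded \<delta> v]
  have upper: "N.variance (\<lambda>\<omega>. real (V \<omega>)) \<le> 2 * v"
    using bounds(1) by (simp add: var)
  have \<delta>_nonneg: "0 \<le> \<delta>"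
    unfolding \<delta>_def statistical_dimension_def by (rule integral_nonneg_AE) simp
  have "\<delta> = (\<Sum>j\<le>CARD('n). w j * real j)"
    by (simp add: \<delta>_def intrinsic_volumes_moments(1)[OF C w])
  also have "\<dots> \<le> (\<Sum>j\<le>CARD('n). w j * ?d)"
    using w_nonneg by (intro sum_mono mult_left_mono) auto
  also have "\<dots> = ?d" using w_sum by (simp flip: sum_distrib_right)
  finally have \<delta>_le: "\<delta> \<le> ?d" .
  have lower: "min (v\<^sup>2) (4 * b\<^sup>2) / b \<le> N.variance (\<lambda>\<omega>. real (V \<omega>))"
  proof (cases "\<delta> = 0")
    case True
    then have "b = 0" using assms(11) by (simp add: \<delta>_def)
    then show ?thesis by (simp add: N.variance_positive)
  next
    case False
    with \<delta>_nonneg have pos: "0 < \<delta>" by simp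
    have "(\<delta> / 2)\<^sup>2 \<le> ?d * \<delta> / 2"
      using \<delta>_le pos mult_right_mono[OF \<delta>_le, of \<delta>] by (simp add: power2_eq_square)
    then have "\<delta> / 2 \<le> b"
      unfolding assms(11) \<delta>_def[symmetric] by (rule real_le_rsqrt)
    then have b: "0 < b" "\<delta> \<le> 2 * b" using pos by auto
    have "min (v\<^sup>2) (4 * b\<^sup>2) / b \<le> v\<^sup>2 / b"
      using b by (intro divide_right_mono) auto
    also have "\<dots> \<le> v\<^sup>2 / (\<delta> / 2)"
      using b pos by (intro divide_left_mono) auto
    also have "\<dots> \<le> N.variance (\<lambda>\<omega>. real (V \<omega>))"
      using bounds(2)[OF pos] by (simp add: var mult.commute)
    finally show ?thesis .
  qed
  from lower upper show ?thesis ..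
qed

end
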